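(* There is a function $\varepsilon:\mathbb{N}\to\mathbb{R}$ with $\varepsilon(k)\to 0$ as $k\to\infty$ such that for all integers $k\ge 1$ and $n$ with $k<\frac n2$, $$\operatorname{coind}_{\mathbb{Z}_2}\bigl(\mathrm{VR}(Q_n,k)\bigr)\ \ge\ (1-\varepsilon(k))\,2k .$$
   Context: The Vietoris--Rips complex $\mathrm{VR}(Q_n,k)$ of the hypercube is the simplicial complex on vertex set $\{0,1\}^n$ whose simplices are all subsets $\sigma\subseteq\{0,1\}^n$ with $d_H(x,y)\le k$ for all $x,y\in\sigma$, where $d_H$ is Hamming distance. It carries the simplicial $\mathbb{Z}_2$-action $x\mapsto\bar x$ (bitwise complement), which is free for $k<n$. For a free $\mathbb{Z}_2$-complex $K$, $\operatorname{coind}_{\mathbb{Z}_2}(K)$ is the maximum $d\ge 0$ for which there is a continuous $\mathbb{Z}_2$-equivariant map $\mathbb{S}^d\to|K|$ to the geometric realization of $K$, where $\mathbb{S}^d$ carries the antipodal action $x\mapsto -x$. *)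

theory Defs
  imports "HOL-Homology.Homology"
begin

definition cube_vertices :: "nat \<Rightarrow> bool list set" where
  "cube_vertices n = {x. length x = n}"

text \<open>Only meant for lists of equal length.\<close>

definition hamming_dist :: "bool list \<Rightarrow> bool list \<Rightarrow> nat" where
  "hamming_dist x y = card {i. i < length x \<and> x ! i \<noteq> y ! i}"

text \<open>As usual, the empty set counts as a simplex; it contributes nothing to the realization.\<close>

definition VR_cube :: "nat \<Rightarrow> nat \<Rightarrow> bool list set set" where
  "VR_cube n k =
     {\<sigma>. \<sigma> \<subseteq> cube_vertices n \<and> (\<forall>x\<in>\<sigma>. \<forall>y\<in>\<sigma>. hamming_dist x y \<le> k)}"

definition bit_complement :: "bool list \<Rightarrow> bool list" where
  "bit_complement x = map Not x"

text \<open>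
  A point of the geometric realization of an abstract simplicial complex \<open>K\<close> is given by its
  barycentric coordinates, whose support must be a simplex of \<open>K\<close>. The product topology used in
  \<open>realization\<close> is the usual topology of the realization for complexes with finitely many vertices;
  the definition is only meant for those.
\<close>

definition realization_points :: "'v set set \<Rightarrow> ('v \<Rightarrow> real) set" where
  "realization_points K =
     {p. (\<forall>v. p v \<ge> 0) \<and> {v. p v \<noteq> 0} \<in> K \<and> (\<Sum>v | p v \<noteq> 0. p v) = 1}"

definition realization :: "'v set set \<Rightarrow> ('v \<Rightarrow> real) topology" where
  "realization K = subtopology (powertop_real UNIV) (realization_points K)"

text \<open>The affine extension of a vertex map to barycentric coordinates.\<close>

definition realize_map :: "('v \<Rightarrow> 'w) \<Rightarrow> ('v \<Rightarrow> real) \<Rightarrow> 'w \<Rightarrow> real" where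
  "realize_map g p w = (\<Sum>v | p v \<noteq> 0 \<and> g v = w. p v)"

text \<open>Here \<open>\<tau>\<close> is the vertex involution that generates the action of the group with two elements.\<close>

definition equivariant_sphere_map ::
  "nat \<Rightarrow> 'v set set \<Rightarrow> ('v \<Rightarrow> 'v) \<Rightarrow> ((nat \<Rightarrow> real) \<Rightarrow> 'v \<Rightarrow> real) \<Rightarrow> bool" where
  "equivariant_sphere_map d K \<tau> f \<longleftrightarrow>
     continuous_map (nsphere d) (realization K) f \<and>
     (\<forall>x \<in> topspace (nsphere d). f (\<lambda>i. - x i) = realize_map \<tau> (f x))"

text \<open>
  The maximum exists for every nonempty finite free complex: there is always an equivariant map
  from the 0-sphere, and the admissible dimensions are bounded by the Borsuk-Ulam theorem.
\<close>

definition coind_Z2 :: "'v set set \<Rightarrow> ('v \<Rightarrow> 'v) \<Rightarrow> nat" where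
  "coind_Z2 K \<tau> = (GREATEST d. \<exists>f. equivariant_sphere_map d K \<tau> f)"

end

theory Submission
  imports Defs "HOL-Real_Asymp.Real_Asymp"
begin

text \<open>
  The coindex is a greatest element, so a lower bound for it needs two things: an equivariant map
  from a sphere of dimension close to \<open>2 * k\<close>, and some bound, however weak, on the dimension of all
  spheres that map equivariantly to the complex.

  For the bound, grid the boundary of a cube into open cells so small that on each closed cell some
  barycentric coordinate of the map stays positive. The coordinates that are positive on the whole
  closed cell span a simplex, which shrinks as the cell grows. The involution on
  nonempty simplices has no fixed point, so it admits a sign, and this sign is odd on the cells. By a parity argument (a
  combinatorial form of the Borsuk--Ulam theorem, \<open>odd_card_alternating_flags\<close>) there is a full flag
  of cells on which the sign alternates. Along such a flag the simplex shrinks strictly at every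
  step, so the dimension of the sphere is less than the number of vertices.

  For the construction, let \<open>D\<close> be a little smaller than \<open>2 * k\<close>. A point of the \<open>D\<close>-sphere is a nonzero
  polynomial of degree at most \<open>D\<close>; its values at \<open>0, ..., n - 1\<close>, scaled up and clamped to the unit interval,
  give an equivariant map to the \<open>D\<close>-skeleton of the cube \<open>[0, 1]^n\<close>, because at most \<open>D\<close> of the values can be small
  (\<open>sphere_to_skeleton\<close>). It remains to map the skeleton to the complex so that each face of the cube
  goes to simplices spanned by vertices of the same face. This is done cell by cell, one cell out of
  each antipodal pair (\<open>carrier_extension\<close>), provided that maps from the boundary of an \<open>r\<close>-cube extend
  over the cube inside the Vietoris--Rips complex of an \<open>r\<close>-face, for all \<open>r \<le> D\<close>.

  The last property has a probabilistic source. Two vertices of an \<open>r\<close>-face, one of them random,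
  differ in about \<open>r / 2\<close> places. Since \<open>k\<close> exceeds \<open>r / 2\<close> by a margin that is large compared with \<open>sqrt r\<close>, the
  probability that the distance exceeds \<open>k\<close> is below \<open>1 / (2 * r)\<close>, hence any \<open>2 * r\<close> vertices of the face
  have a common neighbour (\<open>face_vertices_conical\<close>). A clique complex in which any \<open>2 * r\<close> vertices have a
  common neighbour is \<open>(r - 1)\<close>-connected (\<open>conical_fillable\<close>): a map on the boundary of an \<open>r\<close>-cube is first
  deformed into the \<open>(r - 1)\<close>-skeleton and then, by induction on \<open>r\<close>, to common neighbours of the
  vertices in use and of one fixed vertex, to which it can finally be contracted.
\<close>

section \<open>Involutions and function spaces\<close>

text \<open>
  Choosing one point from every orbit of a fixed-point-free involution amounts to an odd sign function.
\<close>

lemma involution_sign: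
  assumes "\<And>x. x \<in> A \<Longrightarrow> \<iota> (\<iota> x) = x" "\<And>x. x \<in> A \<Longrightarrow> \<iota> x \<noteq> x"
  obtains s :: "'a \<Rightarrow> bool" where "\<And>x. x \<in> A \<Longrightarrow> s (\<iota> x) \<longleftrightarrow> \<not> s x"
proof
  fix x assume "x \<in> A"
  define c where "c = (SOME y. y \<in> {x, \<iota> x})"
  have "c \<in> {x, \<iota> x}" unfolding c_def by (rule someI[of _ x]) simp
  moreover have "{\<iota> x, \<iota> (\<iota> x)} = {x, \<iota> x}" using assms(1)[OF \<open>x \<in> A\<close>] by auto
  ultimately show "(\<iota> x = (SOME y. y \<in> {\<iota> x, \<iota> (\<iota> x)})) \<longleftrightarrow> \<not> (x = (SOME y. y \<in> {x, \<iota> x}))"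
    using assms(2)[OF \<open>x \<in> A\<close>] unfolding c_def by auto
qed

lemma even_card_involution:
  assumes "finite A" "\<And>x. x \<in> A \<Longrightarrow> \<iota> x \<in> A" "\<And>x. x \<in> A \<Longrightarrow> \<iota> (\<iota> x) = x"
    "\<And>x. x \<in> A \<Longrightarrow> \<iota> x \<noteq> x"
  shows "even (card A)"
proof -
  have "card A = (\<Sum>x\<in>A. 1)" by simp
  also have "\<dots> = (\<Sum>P\<in>(\<lambda>x. {x, \<iota> x}) ` A. \<Sum>x\<in>{x\<in>A. {x, \<iota> x} = P}. 1)"
    by (rule sum.image_gen[OF assms(1)])
  also have "\<dots> = (\<Sum>P\<in>(\<lambda>x. {x, \<iota> x}) ` A. 2)"
  proof (rule sum.cong)
    fix P assume "P \<in> (\<lambda>x. {x, \<iota> x}) ` A"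
    then obtain x where x: "x \<in> A" "P = {x, \<iota> x}" by blast
    have "{y\<in>A. {y, \<iota> y} = P} = {x, \<iota> x}"
      using assms(2)[OF x(1)] assms(3)[OF x(1)] x by auto
    then show "(\<Sum>x\<in>{x\<in>A. {x, \<iota> x} = P}. 1) = 2"
      using assms(4)[OF x(1)] by simp
  qed simp
  finally show ?thesis by simp
qed

lemma compact_product_fun:
  fixes K :: "'a \<Rightarrow> real set"
  assumes "\<And>i. compact (K i)"
  shows "compact {x. \<forall>i. x i \<in> K i}"
proof -
  have "compactin (product_topology (\<lambda>i. euclidean) UNIV) (Pi\<^sub>E UNIV K)"
    using assms by (simp add: compactin_PiE compactin_euclidean_iff)
  then show ?thesis
    unfolding euclidean_product_topology compactin_euclidean_iff by (simp add: PiE_def Pi_def)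
qed

lemma continuous_on_coord: "continuous_on S (\<lambda>x::'a \<Rightarrow> real. x i)"
  by (rule continuous_on_product_then_coordinatewise) (rule continuous_on_id)

lemma closed_Collect_coordinate:
  fixes i :: 'a and C :: "real set"
  assumes "closed C"
  shows "closed {x::'a \<Rightarrow> real. x i \<in> C}"
proof -
  have "closed ((\<lambda>x::'a \<Rightarrow> real. x i) -` C)"
    by (rule closed_vimage[OF assms continuous_on_coord])
  then show ?thesis unfolding vimage_def .
qed

text \<open>
  Uniform continuity in the form used for grids: closeness is measured in the maximum norm instead
  of the metric of the countable product.
\<close>

lemma uniformly_continuous_coordinates:
  fixes f :: "('a::countable \<Rightarrow> real) \<Rightarrow> 'v \<Rightarrow> real"
  assumes "compact S" "continuous_on S f" "finite W" "e > 0"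
  obtains \<delta> where "\<delta> > 0"
    "\<And>x y v. \<lbrakk>x \<in> S; y \<in> S; \<And>i. \<bar>x i - y i\<bar> \<le> \<delta>; v \<in> W\<rbrakk> \<Longrightarrow> \<bar>f x v - f y v\<bar> < e"
proof -
  have one: "\<exists>\<delta>>0. \<forall>x\<in>S. \<forall>y\<in>S. (\<forall>i. \<bar>x i - y i\<bar> \<le> \<delta>) \<longrightarrow> \<bar>f x v - f y v\<bar> < e" for v
  proof -
    have "uniformly_continuous_on S (\<lambda>x. f x v)"
      by (rule compact_uniformly_continuous[OF continuous_on_product_then_coordinatewise[OF assms(2)] assms(1)])
    then obtain d where d: "d > 0" "\<And>x y. x \<in> S \<Longrightarrow> y \<in> S \<Longrightarrow> dist y x < d \<Longrightarrow> dist (f y v) (f x v) < e"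
      using \<open>e > 0\<close> unfolding uniformly_continuous_on_def by metis
    obtain N where N: "(1/2::real) ^ N < d / 2"
      using real_arch_pow_inv[of "d/2" "1/2"] d(1) by auto
    have "\<bar>f x v - f y v\<bar> < e" if "x \<in> S" "y \<in> S" "\<forall>i. \<bar>x i - y i\<bar> \<le> d / 4" for x y
    proof -
      have "Max {dist (x (from_nat n)) (y (from_nat n)) | n. n \<le> N} \<le> d / 4"
        using that(3) by (subst Max_le_iff) (auto simp: dist_real_def)
      then have "dist x y < d" using dist_fun_le_dist_first_terms[of x y N] N by linarith
      then show ?thesis using d(2)[OF that(2,1)] by (simp add: dist_real_def)
    qed
    then show ?thesis using d(1) by (intro exI[of _ "d/4"]) auto
  qed
  from \<open>finite W\<close> have "\<exists>\<delta>>0. \<forall>x\<in>S. \<forall>y\<in>S. (\<forall>i. \<bar>x i - y i\<bar> \<le> \<delta>) \<longrightarrow> (\<forall>v\<in>W. \<bar>f x v - f y v\<bar> < e)"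
  proof (induction W)
    case empty
    then show ?case by (intro exI[of _ 1]) auto
  next
    case (insert v W)
    obtain d1 where d1: "d1 > 0" "\<forall>x\<in>S. \<forall>y\<in>S. (\<forall>i. \<bar>x i - y i\<bar> \<le> d1) \<longrightarrow> (\<forall>v\<in>W. \<bar>f x v - f y v\<bar> < e)"
      using insert.IH by blast
    obtain d2 where d2: "d2 > 0" "\<forall>x\<in>S. \<forall>y\<in>S. (\<forall>i. \<bar>x i - y i\<bar> \<le> d2) \<longrightarrow> \<bar>f x v - f y v\<bar> < e"
      using one by blast
    show ?case using d1 d2 by (intro exI[of _ "min d1 d2"]) auto
  qed
  then show thesis using that by blast
qed

lemma continuous_on_real_coordinatewise:
  "(\<And>v. continuous_on S (\<lambda>x. f x v)) \<Longrightarrow> continuous_on S (f :: _ \<Rightarrow> _ \<Rightarrow> real)"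
  by (rule continuous_on_coordinatewise_then_product)

lemma continuous_on_Max_real:
  fixes f :: "'i \<Rightarrow> 'a::topological_space \<Rightarrow> real"
  assumes "finite A" "A \<noteq> {}" "\<And>a. a \<in> A \<Longrightarrow> continuous_on S (f a)"
  shows "continuous_on S (\<lambda>x. Max ((\<lambda>a. f a x) ` A))"
  using assms
proof (induction A rule: finite_ne_induct)
  case (insert a A)
  then have "continuous_on S (\<lambda>x. max (f a x) (Max ((\<lambda>a. f a x) ` A)))"
    by (intro continuous_on_max) auto
  then show ?case using insert by simp
qed simp

section \<open>Flags of grid cells on a sphere\<close>

text \<open>
  A function \<open>w\<close> encodes a product of points and open intervals, coordinate by coordinate: an even
  entry is the point itself, an odd entry is the open interval between its two even neighbours.
  The relation says that \<open>w\<close> is a facet of \<open>w'\<close>.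
\<close>

definition covers :: "(nat \<Rightarrow> int) \<Rightarrow> (nat \<Rightarrow> int) \<Rightarrow> bool" where
  "covers w w' \<longleftrightarrow> (\<exists>a s. even (w a) \<and> (s = 1 \<or> s = - 1) \<and> w' = w(a := w a + s))"

text \<open>
  For even \<open>N\<close> these are the cells on the boundary of the cube \<open>[-N, N]^(j+1)\<close>: an entry of absolute
  value \<open>N\<close> is even, so the whole cell lies in a facet of the cube.
\<close>

definition grid_sphere :: "int \<Rightarrow> nat \<Rightarrow> (nat \<Rightarrow> int) set" where
  "grid_sphere N j = {w. (\<forall>i>j. w i = 0) \<and> (\<forall>i\<le>j. \<bar>w i\<bar> \<le> N) \<and> (\<exists>i\<le>j. \<bar>w i\<bar> = N)}"

text \<open>
  The entry at \<open>t \<le> j\<close> is a cell of dimension \<open>t\<close>. The value beyond \<open>j\<close> is fixed so that flags are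
  finitely many and two flags agree once they agree up to \<open>j\<close>.
\<close>

definition flags :: "(nat \<Rightarrow> int) set \<Rightarrow> nat \<Rightarrow> (nat \<Rightarrow> nat \<Rightarrow> int) set" where
  "flags H j = {F. (\<forall>t\<le>j. F t \<in> H) \<and> (\<forall>i. even (F 0 i)) \<and>
     (\<forall>t<j. covers (F t) (F (Suc t))) \<and> (\<forall>t>j. F t = (\<lambda>_. 0))}"

lemma finite_grid_sphere: "finite (grid_sphere N j)"
proof (rule finite_subset)
  show "finite {w. \<forall>i. (i \<in> {..j} \<longrightarrow> w i \<in> {-N..N}) \<and> (i \<notin> {..j} \<longrightarrow> w i = (0::int))}"
    by (rule finite_set_of_finite_funs) auto
  show "grid_sphere N j \<subseteq> {w. \<forall>i. (i \<in> {..j} \<longrightarrow> w i \<in> {-N..N}) \<and> (i \<notin> {..j} \<longrightarrow> w i = (0::int))}"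
    by (auto simp: grid_sphere_def abs_le_iff)
qed

lemma finite_flags: assumes "finite H" shows "finite (flags H j)"
proof (rule finite_subset)
  show "finite {F. \<forall>t. (t \<in> {..j} \<longrightarrow> F t \<in> H) \<and> (t \<notin> {..j} \<longrightarrow> F t = (\<lambda>_. 0 :: int))}"
    by (rule finite_set_of_finite_funs) (use assms in auto)
qed (auto simp: flags_def)

lemma covers_even: "covers w w' \<Longrightarrow> even (w' i) \<Longrightarrow> w' i = w i"
  by (auto simp: covers_def split: if_splits)

lemma flags_rank:
  assumes "F \<in> flags H j" "t \<le> j"
  shows "finite {i. odd (F t i)} \<and> card {i. odd (F t i)} = t"
  using assms(2)
proof (induction t)
  case 0
  then show ?case using assms(1) by (simp add: flags_def)
next
  case (Suc t)
  then have IH: "finite {i. odd (F t i)}" "card {i. odd (F t i)} = t" and "covers (F t) (F (Suc t))"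
    using assms(1) by (auto simp: flags_def)
  then obtain a s where a: "even (F t a)" "s = 1 \<or> s = - 1" "F (Suc t) = (F t)(a := F t a + s)"
    by (auto simp: covers_def)
  then have "{i. odd (F (Suc t) i)} = insert a {i. odd (F t i)}" by auto
  then show ?case using IH a(1) by simp
qed

lemma grid_sphere_covers:
  assumes "even N" "covers w w'" "w' \<in> grid_sphere N j"
  shows "w \<in> grid_sphere N j"
proof -
  obtain a s where a: "even (w a)" "s = 1 \<or> s = - 1" "w' = w(a := w a + s)"
    using assms(2) by (auto simp: covers_def)
  have odd: "odd (w' a)" using a by auto
  have "w' a \<noteq> 0" using odd by auto
  then have "a \<le> j" using assms(3) by (metis (mono_tags, lifting) grid_sphere_def mem_Collect_eq not_le)
  then have "\<bar>w' a\<bar> \<le> N" using assms(3) by (auto simp: grid_sphere_def)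
  moreover have "\<bar>w' a\<bar> \<noteq> N" using odd assms(1) by auto
  ultimately have "\<bar>w a\<bar> \<le> N" using a by auto
  moreover obtain i where i: "i \<le> j" "\<bar>w' i\<bar> = N" using assms(3) by (auto simp: grid_sphere_def)
  moreover have "i \<noteq> a" using i \<open>\<bar>w' a\<bar> \<noteq> N\<close> by auto
  ultimately show ?thesis using assms(3) a(3) \<open>a \<le> j\<close>
    by (auto simp: grid_sphere_def split: if_splits) 
qed

text \<open>
  An index \<open>i\<close> counts if, disregarding position \<open>i\<close>, the sequence \<open>b\<close> is true before and false after.
  If \<open>b\<close> switches from true to false once, strictly inside, exactly the two positions next to the switch count; if \<open>b\<close> is
  constant, exactly one end does; in all other cases none does.
\<close>

lemma card_switch_parity:
  fixes b :: "nat \<Rightarrow> bool"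
  shows "odd (card {i. i \<le> j \<and> (\<forall>t<i. b t) \<and> (\<forall>t. i < t \<and> t \<le> j \<longrightarrow> \<not> b t)}) \<longleftrightarrow>
    (\<forall>t\<le>j. b t) \<or> (\<forall>t\<le>j. \<not> b t)"
    (is "odd (card ?I) \<longleftrightarrow> _")
proof -
  consider "\<forall>t\<le>j. b t" | "\<forall>t\<le>j. \<not> b t" | "\<not> (\<forall>t\<le>j. b t)" "\<not> (\<forall>t\<le>j. \<not> b t)" by blast
  then show ?thesis
  proof cases
    case 1
    then have "?I = {j}" by (auto simp: le_less)
    then show ?thesis using 1 by simp
  next
    case 2
    then have "?I = {0}" by fastforce
    then show ?thesis using 2 by simp
  next
    case 3
    define a where "a = (LEAST t. \<not> b t)"
    have a: "\<not> b a" "\<And>t. t < a \<Longrightarrow> b t" "a \<le> j"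
      using 3(1) LeastI_ex[of "\<lambda>t. \<not> b t"] not_less_Least[of _ "\<lambda>t. \<not> b t"]
      unfolding a_def by (blast, blast) (meson "3"(1) Least_le dual_order.trans)
    have sub: "a \<le> i + 1 \<and> i \<le> a" if "i \<in> ?I" for i
    proof -
      have "i \<le> a" using that a(1) by (metis (mono_tags, lifting) mem_Collect_eq not_le)
      moreover have "\<not> i + 1 < a"
      proof
        assume "i + 1 < a"
        then have "b (i + 1)" "i + 1 \<le> j" using a by auto
        then show False using that by auto
      qed
      ultimately show ?thesis by simp
    qed
    have "even (card ?I)"
    proof (cases "a = 0")
      case True
      have "?I = {}"
      proof (rule ccontr)
        assume "?I \<noteq> {}"
        then obtain i where i: "i \<in> ?I" by blast
        then have "i = 0" using sub True by auto
        then have "\<forall>t\<le>j. \<not> b t" using i a(1) True by auto (metis gr0I)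
        then show False using 3 by blast
      qed
      then have "card ?I = 0" by (simp only: card.empty)
      then show ?thesis by presburger
    next
      case False
      have eq: "a \<in> ?I \<longleftrightarrow> a - 1 \<in> ?I"
      proof -
        have "(\<forall>t. a - 1 < t \<and> t \<le> j \<longrightarrow> \<not> b t) \<longleftrightarrow> (\<forall>t. a < t \<and> t \<le> j \<longrightarrow> \<not> b t)"
          using a(1) False by (metis Suc_pred' le_neq_implies_less less_Suc_eq_le less_imp_diff_less linorder_not_le neq0_conv not_less_eq)
        then show ?thesis using a by auto
      qed
      have "?I \<subseteq> {a - 1, a}" using sub False by fastforce
      then have "?I = {} \<or> ?I = {a - 1, a}" using eq by blast
      moreover have "card {a - 1, a} = 2" using False by auto
      ultimately have "card ?I = 0 \<or> card ?I = 2" by (elim disjE) (simp_all only: card.empty simp_thms)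
      then show ?thesis by presburger
    qed
    then show ?thesis using 3 by blast
  qed
qed

definition grid_hemisphere :: "int \<Rightarrow> nat \<Rightarrow> (nat \<Rightarrow> int) set" where
  "grid_hemisphere N j = {w \<in> grid_sphere N j. 0 \<le> w j}"

lemma grid_hemisphere_covers:
  assumes "even N" "covers w w'" "w' \<in> grid_hemisphere N j"
  shows "w \<in> grid_hemisphere N j"
proof -
  have "0 \<le> w j"
  proof (cases "even (w' j)")
    case True
    then show ?thesis using covers_even[OF assms(2)] assms(3) by (auto simp: grid_hemisphere_def)
  next
    case False
    have "0 \<le> w' j" using assms(3) by (auto simp: grid_hemisphere_def)
    then have "1 \<le> w' j" using False by (cases "w' j = 0") auto
    then show ?thesis using assms(2) by (auto simp: covers_def split: if_splits)
  qed
  then show ?thesis using grid_sphere_covers[OF assms(1,2)] assms(3) by (auto simp: grid_hemisphere_def)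
qed

lemma flags_below_top:
  assumes down: "\<And>w w'. covers w w' \<Longrightarrow> w' \<in> H \<Longrightarrow> w \<in> H"
    and "F \<in> flags H' m" "F m \<in> H" "t \<le> m"
  shows "F t \<in> H"
  using assms(4)
proof (induction rule: inc_induct)
  case base
  then show ?case using assms by simp
next
  case (step n)
  then show ?case using assms(2) down by (auto simp: flags_def)
qed

lemma flag_top_nonzero:
  assumes F: "F \<in> flags (grid_sphere N m) m" and N: "even N" "N > 0"
  shows "F m m \<noteq> 0"
proof
  assume z: "F m m = 0"
  have sph: "F m \<in> grid_sphere N m" using F by (auto simp: flags_def)
  have "{i. odd (F m i)} \<subseteq> {..<m}"
  proof
    fix i assume "i \<in> {i. odd (F m i)}"
    then have "F m i \<noteq> 0" "odd (F m i)" by (auto intro: ccontr)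
    then have "i \<le> m" using sph by (metis (mono_tags, lifting) grid_sphere_def mem_Collect_eq not_le)
    then show "i \<in> {..<m}" using z \<open>F m i \<noteq> 0\<close> by (auto simp: le_less)
  qed
  then have all: "{i. odd (F m i)} = {..<m}"
    using flags_rank[OF F le_refl] by (simp add: card_subset_eq)
  obtain i where i: "i \<le> m" "\<bar>F m i\<bar> = N" using sph by (auto simp: grid_sphere_def)
  then have "even (F m i)" using N by auto
  then have "i = m" using all i(1) by (auto simp: le_less)
  then show False using i z N by simp
qed

text \<open>
  The cell poset is thin: between two cells whose dimensions differ by two there are exactly two
  others, and reflection in the midpoint exchanges them.
\<close>

lemma covers_diamond:
  assumes "covers u v" "covers v w"
  defines "v' \<equiv> \<lambda>i. u i + w i - v i"
  shows "covers u v'" "covers v' w" "v' \<noteq> v"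
proof -
  obtain a s where a: "even (u a)" "s = 1 \<or> s = - 1" "v = u(a := u a + s)"
    using assms(1) by (auto simp: covers_def)
  obtain b r where b: "even (v b)" "r = 1 \<or> r = - 1" "w = v(b := v b + r)"
    using assms(2) by (auto simp: covers_def)
  have "a \<noteq> b" using a b by auto
  have v': "v' = u(b := u b + r)" using a b \<open>a \<noteq> b\<close> by (auto simp: v'_def)
  have "even (u b)" using a b \<open>a \<noteq> b\<close> by auto
  then show "covers u v'" using v' b by (auto simp: covers_def)
  have "w = v'(a := v' a + s)" "even (v' a)" using a b v' \<open>a \<noteq> b\<close> by auto
  then show "covers v' w" using a unfolding covers_def by blast
  show "v' \<noteq> v" using a b v' \<open>a \<noteq> b\<close> by (metis add_cancel_right_right fun_upd_apply zero_neq_neg_one zero_neq_one)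
qed

text \<open>
  An edge of the grid has two end points, exchanged by reflection in its centre.
\<close>

lemma covers_reflect:
  assumes "covers u v" "\<And>i. even (u i)"
  defines "u' \<equiv> \<lambda>i. 2 * v i - u i"
  shows "covers u' v" "u' \<noteq> u" "even (u' i)"
proof -
  obtain a s where a: "even (u a)" "s = 1 \<or> s = - 1" "v = u(a := u a + s)"
    using assms(1) by (auto simp: covers_def)
  have u': "u' = u(a := u a + 2 * s)" using a by (auto simp: u'_def)
  show "even (u' i)" using assms(2) by (simp add: u'_def)
  have "v = u'(a := u' a + (- s))" "even (u' a)" using a u' by auto
  moreover have "- s = 1 \<or> - s = - 1" using a by auto
  ultimately show "covers u' v" unfolding covers_def by blast
  show "u' \<noteq> u"
  proof
    assume "u' = u"
    then have "u' a = u a" by simp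
    then show False using u' a(2) by auto
  qed
qed

text \<open>
  Flags that agree except at one place below the top come in pairs, so any property that ignores this
  place holds for an even number of them.
\<close>

lemma even_card_flags_inner:
  assumes down: "\<And>w w'. covers w w' \<Longrightarrow> w' \<in> H \<Longrightarrow> w \<in> H" and "finite H" and "i < m"
    and P: "\<And>F v. P (F(i := v)) \<longleftrightarrow> P F"
  shows "even (card {F \<in> flags H m. P F})"
proof -
  define other where "other F = (if i = 0 then (\<lambda>k. 2 * F 1 k - F 0 k)
      else (\<lambda>k. F (i - 1) k + F (i + 1) k - F i k))" for F :: "nat \<Rightarrow> nat \<Rightarrow> int"
  show ?thesis
  proof (rule even_card_involution[where \<iota> = "\<lambda>F. F(i := other F)"])
    show "finite {F \<in> flags H m. P F}" using finite_flags[OF \<open>finite H\<close>] by simp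
    fix F assume "F \<in> {F \<in> flags H m. P F}"
    then have F: "F \<in> flags H m" "P F" by auto
    have step: "covers (F t) (F (Suc t))" if "t < m" for t using F that by (auto simp: flags_def)
    have up: "covers (other F) (F (Suc i)) \<and> other F \<noteq> F i"
    proof (cases "i = 0")
      case True
      then show ?thesis using covers_reflect[OF step[OF \<open>i < m\<close>]] F
        by (auto simp: other_def flags_def)
    next
      case False
      then obtain h where h: "i = Suc h" by (cases i) auto
      show ?thesis using covers_diamond[OF step step, of h] h \<open>i < m\<close>
        by (simp add: other_def)
    qed
    have lo: "covers (F (i - 1)) (other F)" if "i > 0"
    proof -
      obtain h where h: "i = Suc h" using \<open>i > 0\<close> gr0_conv_Suc by blast
      show ?thesis using covers_diamond[OF step step, of h] h \<open>i < m\<close>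
        by (simp add: other_def)
    qed
    have ev: "\<forall>k. even (other F k)" if "i = 0"
      using F that by (auto simp: other_def flags_def)
    have "other F \<in> H" using up down F \<open>i < m\<close> by (auto simp: flags_def)
    then have "F(i := other F) \<in> flags H m"
      using F up lo ev \<open>i < m\<close> unfolding flags_def by (auto)
    then show "F(i := other F) \<in> {F \<in> flags H m. P F}" using P F by simp
    show "F(i := other F) \<noteq> F" using up by (metis fun_upd_same)
    show "(F(i := other F))(i := other (F(i := other F))) = F"
    proof (cases "i = 0")
      case False
      then have "i - 1 \<noteq> i" by simp
      then show ?thesis using False by (simp add: other_def)
    qed (simp add: other_def)
  qed
qed

text \<open>
  A codimension-one cell in the interior of the hemisphere lies in exactly two top cells.
  Since it has \<open>m\<close> odd entries, two of its entries are even. If both lie on the boundary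
  of the cube, then each may move inwards; if only one does, the other may move in both directions.
\<close>

lemma even_card_flags_top:
  assumes N: "even N" "N > 0"
    and P: "\<And>F v. P (F(Suc m := v)) \<longleftrightarrow> P F"
  shows "even (card {F \<in> flags (grid_hemisphere N (Suc m)) (Suc m). P F \<and> F m (Suc m) \<noteq> 0})"
    (is "even (card ?A)")
proof -
  let ?H = "grid_hemisphere N (Suc m)"
  \<comment> \<open>The other top cell over \<open>w\<close>: reflect in \<open>w\<close> if the raised entry was an interior one; otherwise
  raise inwards the entry that is still even. Entries beyond the dimension are 0 and have sign 0.\<close>
  define oth where "oth w w' = (if \<exists>a. w' a \<noteq> w a \<and> \<bar>w a\<bar> < N then (\<lambda>k. 2 * w k - w' k)
      else (\<lambda>k. if even (w' k) then w k - sgn (w k) else w k))" for w w' :: "nat \<Rightarrow> int"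
  define other where "other F = oth (F m) (F (Suc m))" for F :: "nat \<Rightarrow> nat \<Rightarrow> int"
  have finH: "finite ?H"
    using finite_grid_sphere by (rule finite_subset[rotated]) (auto simp: grid_hemisphere_def)
  show ?thesis
  proof (rule even_card_involution[where \<iota> = "\<lambda>F. F(Suc m := other F)"])
    show "finite ?A" using finite_flags[OF finH] by simp
    fix F assume "F \<in> ?A"
    then have F: "F \<in> flags ?H (Suc m)" "P F" "F m (Suc m) \<noteq> 0" by auto
    define w w' where "w = F m" and "w' = F (Suc m)"
    have "covers w w'" using F by (auto simp: flags_def w_def w'_def)
    then obtain a s where a: "even (w a)" "s = 1 \<or> s = - 1" "w' = w(a := w a + s)"
      by (auto simp: covers_def)
    have wH: "w \<in> ?H" "w' \<in> ?H" using F by (auto simp: flags_def w_def w'_def)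
    have sup: "k \<le> Suc m" if "odd (w' k)" for k
    proof (rule ccontr)
      assume "\<not> k \<le> Suc m"
      then have "w' k = 0" using wH by (auto simp: grid_hemisphere_def grid_sphere_def)
      then show False using that by simp
    qed
    have "a \<le> Suc m" using sup[of a] a by auto
    have rank: "finite {i. odd (w' i)}" "card {i. odd (w' i)} = Suc m"
      using flags_rank[OF F(1), of "Suc m"] by (auto simp: w'_def)
    have "card ({..Suc m} - {i. odd (w' i)}) = 1"
      using rank sup by (subst card_Diff_subset) auto
    then obtain b where b: "{..Suc m} - {i. odd (w' i)} = {b}" by (auto simp: card_1_singleton_iff)
    then have bm: "b \<le> Suc m" "even (w' b)" and bu: "\<And>k. k \<le> Suc m \<Longrightarrow> even (w' k) \<Longrightarrow> k = b"
      by auto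
    have "a \<noteq> b" using a bm by auto
    obtain i where i: "i \<le> Suc m" "\<bar>w' i\<bar> = N" using wH by (auto simp: grid_hemisphere_def grid_sphere_def)
    then have "even (w' i)" using N by (metis abs_dvd_iff dvd_abs_iff)
    then have bN: "\<bar>w b\<bar> = N" using bu i a \<open>a \<noteq> b\<close> by auto
    have zero: "w k = 0" if "k > Suc m" for k
      using wH that by (auto simp: grid_hemisphere_def grid_sphere_def)
    have bounds: "\<bar>w k\<bar> \<le> N" if "k \<le> Suc m" for k
      using wH that by (auto simp: grid_hemisphere_def grid_sphere_def)
    have low: "0 \<le> w (Suc m)" "w (Suc m) \<noteq> 0" using wH F by (auto simp: grid_hemisphere_def w_def)
    have ex: "(\<exists>a. w' a \<noteq> w a \<and> \<bar>w a\<bar> < N) \<longleftrightarrow> \<bar>w a\<bar> < N" using a by auto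
    have main: "covers w (other F) \<and> other F \<in> ?H \<and> other F \<noteq> w' \<and> other (F(Suc m := other F)) = w'"
    proof (cases "\<bar>w a\<bar> < N")
      case True
      have o: "other F = w(a := w a - s)"
      proof -
        have "other F = (\<lambda>k. 2 * w k - w' k)"
          using True ex by (simp add: other_def oth_def w_def w'_def)
        then show ?thesis using a(3) by auto
      qed
      have "covers w (other F)" unfolding covers_def o using a(1,2) by (intro exI[of _ a] exI[of _ "-s"]) auto
      moreover have "other F \<in> ?H"
      proof -
        have "\<bar>w a - s\<bar> \<le> N" using True a(2) by auto
        moreover have "a = Suc m \<Longrightarrow> 0 \<le> w a - s" using low a(1,2) by auto
        ultimately show ?thesis using wH \<open>a \<le> Suc m\<close> o bN bm(1) \<open>a \<noteq> b\<close>
          by (auto simp: grid_hemisphere_def grid_sphere_def intro!: exI[of _ b])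
      qed
      moreover have "other F \<noteq> w'"
      proof
        assume "other F = w'"
        then have "(w(a := w a - s)) a = w' a" using o by simp
        then show False using a by auto
      qed
      moreover have "other (F(Suc m := other F)) = w'"
      proof -
        have "\<exists>k. (w(a := w a - s)) k \<noteq> w k \<and> \<bar>w k\<bar> < N"
          using True a by (intro exI[of _ a]) auto
        then have "oth w (w(a := w a - s)) = (\<lambda>k. 2 * w k - (w(a := w a - s)) k)"
          by (simp only: oth_def if_True simp_thms)
        also have "\<dots> = w'" using a(3) by auto
        finally show ?thesis unfolding o by (simp add: other_def w_def)
      qed
      ultimately show ?thesis by blast
    next
      case False
      then have aN: "\<bar>w a\<bar> = N" using bounds[OF \<open>a \<le> Suc m\<close>] by auto
      have o: "other F = w(b := w b - sgn (w b))"
      proof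
        fix k
        have o1: "other F = (\<lambda>k. if even (w' k) then w k - sgn (w k) else w k)"
          using False ex by (simp only: other_def oth_def w_def[symmetric] w'_def[symmetric] if_False simp_thms)
        show "other F k = (w(b := w b - sgn (w b))) k"
        proof (cases "k = b")
          case True
          then have "even (w' k)" using bm by simp
          then show ?thesis using o1 True by simp
        next
          case False
          then have "odd (w' k) \<or> w k = 0" using bu[of k] zero[of k] by (cases "k \<le> Suc m") auto
          then show ?thesis using o1 False by auto
        qed
      qed
      have sg: "sgn (w b) = 1 \<or> sgn (w b) = - 1" using bN N by (auto simp: sgn_if)
      have evb: "even (w b)" using bN N by (metis abs_dvd_iff dvd_abs_iff)
      have "covers w (other F)" unfolding covers_def o using evb sg
        by (intro exI[of _ b] exI[of _ "- sgn (w b)"]) auto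
      moreover have "other F \<in> ?H"
      proof -
        have "\<bar>w b - sgn (w b)\<bar> \<le> N" using bN N by (auto simp: sgn_if)
        moreover have "b = Suc m \<Longrightarrow> 0 \<le> w b - sgn (w b)" using low by (auto simp: sgn_if)
        ultimately show ?thesis using wH \<open>b \<le> Suc m\<close> o aN \<open>a \<le> Suc m\<close> \<open>a \<noteq> b\<close>
          by (auto simp: grid_hemisphere_def grid_sphere_def intro!: exI[of _ a])
      qed
      moreover have "other F \<noteq> w'"
      proof
        assume "other F = w'"
        then have "(w(b := w b - sgn (w b))) b = w' b" using o by simp
        then show False using a sg \<open>a \<noteq> b\<close> by auto
      qed
      moreover have "other (F(Suc m := other F)) = w'"
      proof -
        let ?v = "w(b := w b - sgn (w b))"
        have n: "\<not> (\<exists>k. ?v k \<noteq> w k \<and> \<bar>w k\<bar> < N)" using bN by auto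
        have "s = - sgn (w a)"
        proof -
          have "\<bar>w a + s\<bar> \<le> N" using wH(2) a(3) \<open>a \<le> Suc m\<close>
            by (auto simp: grid_hemisphere_def grid_sphere_def)
          then show ?thesis using aN a(2) N by (auto simp: sgn_if split: if_splits)
        qed
        have od: "odd (?v b)" using evb sg by auto
        have "(if even (?v k) then w k - sgn (w k) else w k) = w' k" for k
        proof -
          consider "k = a" | "k = b" | "k > Suc m" "k \<noteq> a" "k \<noteq> b" | "k \<le> Suc m" "k \<noteq> a" "k \<noteq> b" by linarith
          then show ?thesis
          proof cases
            case 1
            then show ?thesis using a \<open>a \<noteq> b\<close> \<open>s = - sgn (w a)\<close> by auto
          next
            case 2
            then show ?thesis using od a \<open>a \<noteq> b\<close> by auto
          next
            case 3
            then show ?thesis using zero a by auto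
          next
            case 4
            then have "odd (w' k)" using bu by auto
            then show ?thesis using a 4 by auto
          qed
        qed
        then have "oth w ?v = w'"
          unfolding oth_def if_not_P[OF n] by blast
        then show ?thesis unfolding o by (simp add: other_def w_def)
      qed
      ultimately show ?thesis by blast
    qed
    have "F(Suc m := other F) \<in> flags ?H (Suc m)"
      using F(1) main unfolding flags_def w_def by (auto simp: less_Suc_eq)
    then show "F(Suc m := other F) \<in> ?A" using P F by simp
    show "F(Suc m := other F) \<noteq> F" using main w'_def by (metis fun_upd_same)
    show "(F(Suc m := other F))(Suc m := other (F(Suc m := other F))) = F"
      using main by (simp add: w'_def)
  qed
qed

text \<open>
  Combinatorial Borsuk--Ulam theorem, by induction on the dimension. Count the pairs of a full flag
  \<open>F\<close> of the closed upper hemisphere and an index \<open>i\<close> such that the signs alternate, starting with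
  a positive one, when \<open>F i\<close> is skipped. Counted by \<open>F\<close>, the parity is that of the alternating
  flags in the hemisphere, and by oddness those starting with a negative sign correspond to the alternating
  flags of the lower hemisphere that start with a positive one. Counted by \<open>i\<close>, everything cancels in pairs except the
  flags whose truncation is an alternating flag of the equator.
\<close>

theorem odd_card_alternating_flags:
  assumes N: "even N" "N > 0"
    and \<epsilon>: "\<And>w. w \<in> grid_sphere N d \<Longrightarrow> \<epsilon> (\<lambda>i. - w i) \<longleftrightarrow> \<not> \<epsilon> w"
    and "j \<le> d"
  shows "odd (card {F \<in> flags (grid_sphere N j) j. \<forall>t\<le>j. \<epsilon> (F t) \<longleftrightarrow> even t})"
  using \<open>j \<le> d\<close>
proof (induction j)
  case 0
  define p where "p s = (\<lambda>i::nat. if i = 0 then s * N else 0)" for s :: int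
  have mem: "w \<in> grid_sphere N 0 \<longleftrightarrow> w = p 1 \<or> w = p (-1)" for w
    using N by (auto simp: grid_sphere_def p_def fun_eq_iff abs_if split: if_splits)
  have neg: "(\<lambda>i. - p 1 i) = p (-1)" by (auto simp: p_def)
  have "p 1 \<in> grid_sphere N d" using N by (auto simp: grid_sphere_def p_def)
  then have "\<epsilon> (p (-1)) \<longleftrightarrow> \<not> \<epsilon> (p 1)" using \<epsilon>[of "p 1"] neg by simp
  then obtain s where s: "s = 1 \<or> s = -1" "\<epsilon> (p s)" "\<not> \<epsilon> (p (- s))"
    by (metis minus_minus)
  have ev: "even (p r i)" for r i using N(1) by (simp add: p_def)
  have mem': "w \<in> grid_sphere N 0 \<longleftrightarrow> w = p s \<or> w = p (- s)" for w
    using s(1) mem by (metis minus_minus)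
  have "{F \<in> flags (grid_sphere N 0) 0. \<forall>t\<le>0. \<epsilon> (F t) \<longleftrightarrow> even t} = {(\<lambda>t. if t = 0 then p s else (\<lambda>_. 0))}"
    (is "?L = {?F}")
  proof (rule Set.set_eqI)
    fix F
    have "F \<in> ?L \<longleftrightarrow> F 0 = p s \<and> (\<forall>t>0. F t = (\<lambda>_. 0))"
      using s(2,3) ev by (auto simp: flags_def mem')
    also have "\<dots> \<longleftrightarrow> F = ?F" by (auto simp: fun_eq_iff)
    finally show "F \<in> ?L \<longleftrightarrow> F \<in> {?F}" by simp
  qed
  then show ?case by simp
next
  case (Suc n)
  define m where "m = Suc n"
  define S where "S = flags (grid_sphere N m) m"
  define G where "G = flags (grid_hemisphere N m) m"
  define b where "b F t \<longleftrightarrow> (\<epsilon> (F t) \<longleftrightarrow> even t)" for F :: "nat \<Rightarrow> nat \<Rightarrow> int" and t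
  define E where "E F i \<longleftrightarrow> (\<forall>t<i. b F t) \<and> (\<forall>t. i < t \<and> t \<le> m \<longrightarrow> \<not> b F t)" for F i
  have down: "covers w w' \<Longrightarrow> w' \<in> grid_hemisphere N m \<Longrightarrow> w \<in> grid_hemisphere N m" for w w'
    using grid_hemisphere_covers N by blast
  have finH: "finite (grid_hemisphere N m)"
    using finite_grid_sphere by (rule finite_subset[rotated]) (auto simp: grid_hemisphere_def)
  have finS: "finite S" and finG: "finite G"
    unfolding S_def G_def by (simp_all add: finite_flags finite_grid_sphere finH)
  have GS: "G = {F \<in> S. F m m > 0}"
  proof (rule Set.set_eqI)
    fix F
    show "F \<in> G \<longleftrightarrow> F \<in> {F \<in> S. F m m > 0}"
    proof
      assume F: "F \<in> G"
      then have "F \<in> S" by (auto simp: S_def G_def flags_def grid_hemisphere_def)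
      moreover have "F m m \<ge> 0" using F by (auto simp: G_def flags_def grid_hemisphere_def)
      ultimately show "F \<in> {F \<in> S. F m m > 0}"
        using flag_top_nonzero[of F N m] N by (auto simp: S_def le_less)
    next
      assume F: "F \<in> {F \<in> S. F m m > 0}"
      then have top: "F m \<in> grid_hemisphere N m" by (auto simp: S_def flags_def grid_hemisphere_def)
      have "F t \<in> grid_hemisphere N m" if "t \<le> m" for t
      proof (rule flags_below_top[where F = F and m = m, OF _ _ top that])
        show "F \<in> flags (grid_sphere N m) m" using F by (simp add: S_def)
      qed (rule down)
      then show "F \<in> G" using F by (auto simp: S_def G_def flags_def)
    qed
  qed
  have sub: "w \<in> grid_sphere N d" if "w \<in> grid_sphere N j" "j \<le> d" for w j
  proof -
    from that obtain i where "i \<le> j" "\<bar>w i\<bar> = N" by (auto simp: grid_sphere_def)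
    moreover have "\<bar>w k\<bar> \<le> N" for k using that N(2) by (cases "k \<le> j") (auto simp: grid_sphere_def)
    ultimately show ?thesis using that unfolding grid_sphere_def
      by (intro CollectI conjI exI[of _ i]) auto
  qed
  have neg_b: "b (\<lambda>t i. - F t i) t \<longleftrightarrow> \<not> b F t" if "F \<in> S" "t \<le> m" for F t
    using \<epsilon>[OF sub[of "F t" m]] that Suc.prems by (auto simp: b_def S_def flags_def m_def)
  have neg_S: "(\<lambda>t i. - F t i) \<in> S" if "F \<in> S" for F
  proof -
    have "covers (\<lambda>i. - w i) (\<lambda>i. - w' i)" if "covers w w'" for w w'
    proof -
      obtain a s where "even (w a)" "s = 1 \<or> s = - 1" "w' = w(a := w a + s)"
        using \<open>covers w w'\<close> by (auto simp: covers_def)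
      then show ?thesis unfolding covers_def by (intro exI[of _ a] exI[of _ "-s"]) auto
    qed
    then show ?thesis using that by (auto simp: S_def flags_def grid_sphere_def)
  qed
  \<comment> \<open>Negation maps the lower hemisphere to the upper one and turns alternating flags that start with a
  positive sign into those that start with a negative one.\<close>
  have bij: "card {F \<in> S. (\<forall>t\<le>m. b F t) \<and> F m m < 0} = card {F \<in> S. (\<forall>t\<le>m. \<not> b F t) \<and> F m m > 0}"
  proof (rule bij_betw_same_card)
    define neg where "neg F = (\<lambda>t i. - F t i)" for F :: "nat \<Rightarrow> nat \<Rightarrow> int"
    have nn: "neg (neg F) = F" and nm: "neg F m m = - F m m" for F by (auto simp: neg_def)
    have nS: "F \<in> S \<Longrightarrow> neg F \<in> S" for F using neg_S by (simp add: neg_def)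
    have nb: "F \<in> S \<Longrightarrow> t \<le> m \<Longrightarrow> b (neg F) t \<longleftrightarrow> \<not> b F t" for F t using neg_b by (simp add: neg_def)
    show "bij_betw neg {F \<in> S. (\<forall>t\<le>m. b F t) \<and> F m m < 0} {F \<in> S. (\<forall>t\<le>m. \<not> b F t) \<and> F m m > 0}"
      by (rule bij_betw_byWitness[where f' = neg]) (simp_all add: nn nm nS nb image_subset_iff)
  qed
  have split: "card {F \<in> A. P F \<or> Q F} = card {F \<in> A. P F} + card {F \<in> A. Q F}"
    if "finite A" "\<And>F. \<not> (P F \<and> Q F)" for A and P Q :: "(nat \<Rightarrow> nat \<Rightarrow> int) \<Rightarrow> bool"
  proof -
    have "{F \<in> A. P F \<or> Q F} = {F \<in> A. P F} \<union> {F \<in> A. Q F}" by blast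
    then show ?thesis using that by (simp only:) (rule card_Un_disjoint, auto)
  qed
  have sgn: "F m m > 0 \<or> F m m < 0" if "F \<in> S" for F
    using flag_top_nonzero[of F N m] N that unfolding S_def by linarith
  have "{F \<in> S. \<forall>t\<le>m. b F t} =
      {F \<in> S. (\<forall>t\<le>m. b F t) \<and> F m m > 0 \<or> (\<forall>t\<le>m. b F t) \<and> F m m < 0}"
    using sgn by blast
  then have "card {F \<in> S. \<forall>t\<le>m. b F t} =
      card {F \<in> S. (\<forall>t\<le>m. b F t) \<and> F m m > 0} + card {F \<in> S. (\<forall>t\<le>m. b F t) \<and> F m m < 0}"
    by (simp only:) (rule split[OF finS], linarith)
  also have "\<dots> = card {F \<in> S. (\<forall>t\<le>m. b F t) \<and> F m m > 0} + card {F \<in> S. (\<forall>t\<le>m. \<not> b F t) \<and> F m m > 0}"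
    by (simp only: bij)
  also have "\<dots> = card {F \<in> S. (\<forall>t\<le>m. b F t) \<and> F m m > 0 \<or> (\<forall>t\<le>m. \<not> b F t) \<and> F m m > 0}"
    by (rule split[OF finS, symmetric]) (use order_refl in blast)
  finally have e1: "card {F \<in> S. \<forall>t\<le>m. b F t} =
      card {F \<in> S. (\<forall>t\<le>m. b F t) \<and> F m m > 0 \<or> (\<forall>t\<le>m. \<not> b F t) \<and> F m m > 0}" .
  have e2: "{F \<in> S. (\<forall>t\<le>m. b F t) \<and> F m m > 0 \<or> (\<forall>t\<le>m. \<not> b F t) \<and> F m m > 0} =
      {F \<in> G. odd (card {i. i \<le> m \<and> E F i})}"
    by (simp only: E_def card_switch_parity GS mem_Collect_eq) blast
  have e3: "odd (card {F \<in> G. odd (card {i. i \<le> m \<and> E F i})}) \<longleftrightarrow> odd (\<Sum>F\<in>G. card {i. i \<le> m \<and> E F i})"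
    by (simp only: even_sum_iff[OF finG])
  have e4: "(\<Sum>F\<in>G. card {i. i \<le> m \<and> E F i}) = (\<Sum>i\<le>m. card {F \<in> G. E F i})"
    using sum.swap_restrict[of G "{..m}" "\<lambda>_ _. 1 :: nat" E] finG by simp
  have e5: "(\<Sum>i\<le>m. card {F \<in> G. E F i}) = (\<Sum>i<m. card {F \<in> G. E F i}) + card {F \<in> G. E F m}"
    by (simp add: lessThan_Suc_atMost[symmetric])
  have e6: "even (\<Sum>i<m. card {F \<in> G. E F i})"
  proof -
    have "even (card {F \<in> G. E F i})" if "i < m" for i
      unfolding G_def by (rule even_card_flags_inner[OF down finH that]) (auto simp: E_def b_def)
    then show ?thesis by (intro dvd_sum) auto
  qed
  have e7: "{F \<in> G. E F m} = {F \<in> G. E F m \<and> F n m \<noteq> 0 \<or> E F m \<and> F n m = 0}"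
    by blast
  have e8: "card {F \<in> G. E F m \<and> F n m \<noteq> 0 \<or> E F m \<and> F n m = 0} = card {F \<in> G. E F m \<and> F n m \<noteq> 0} + card {F \<in> G. E F m \<and> F n m = 0}"
    by (rule split[OF finG]) blast
  have e9: "even (card {F \<in> G. E F m \<and> F n m \<noteq> 0})"
    unfolding G_def m_def by (rule even_card_flags_top[OF N]) (auto simp: E_def b_def m_def)
  \<comment> \<open>Over a top cell of the equator the upper hemisphere has a single cell, with last entry 1.\<close>
  have e10: "card {F \<in> G. E F m \<and> F n m = 0} =
      card {F \<in> flags (grid_sphere N n) n. \<forall>t\<le>n. \<epsilon> (F t) \<longleftrightarrow> even t}"
  proof (rule bij_betw_same_card)
    let ?A = "{F \<in> G. E F m \<and> F n m = 0}"
    let ?B = "{F \<in> flags (grid_sphere N n) n. \<forall>t\<le>n. \<epsilon> (F t) \<longleftrightarrow> even t}"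
    have EA: "E F m \<longleftrightarrow> (\<forall>t\<le>n. \<epsilon> (F t) \<longleftrightarrow> even t)" for F
      by (auto simp: E_def b_def m_def less_Suc_eq_le)
    show "bij_betw (\<lambda>F. F(m := (\<lambda>_. 0))) ?A ?B"
    proof (rule bij_betw_byWitness[where f' = "\<lambda>F. F(m := (F n)(m := 1))"])
      show "\<forall>F\<in>?A. (F(m := (\<lambda>_. 0)))(m := ((F(m := (\<lambda>_. 0))) n)(m := 1)) = F"
      proof
        fix F assume "F \<in> ?A"
        then have F: "F \<in> flags (grid_hemisphere N m) m" "F n m = 0" by (auto simp: G_def)
        then have "covers (F n) (F m)" by (auto simp: flags_def m_def)
        then obtain a s where a: "even (F n a)" "s = 1 \<or> s = - 1" "F m = (F n)(a := F n a + s)"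
          by (auto simp: covers_def)
        have top: "F \<in> S" "F m m > 0" using F GS by (auto simp: G_def)
        have "a = m" using a(3) top(2) F(2) by (metis fun_upd_other less_irrefl)
        then have "F m = (F n)(m := 1)" using a top(2) F(2) by auto
        then show "(F(m := (\<lambda>_. 0)))(m := ((F(m := (\<lambda>_. 0))) n)(m := 1)) = F"
          by (simp add: m_def fun_upd_idem)
      qed
      show "\<forall>F\<in>?B. (F(m := (F n)(m := 1)))(m := (\<lambda>_. 0)) = F"
        by (auto simp: flags_def m_def fun_upd_idem)
      show "(\<lambda>F. F(m := (\<lambda>_. 0))) ` ?A \<subseteq> ?B"
      proof clarify
        fix F assume F: "F \<in> G" "E F m" "F n m = 0"
        have z: "F t m = 0" if "t \<le> n" for t
          using that
        proof (induction rule: inc_induct)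
          case (step t)
          then have "covers (F t) (F (Suc t))" using F by (auto simp: G_def flags_def m_def)
          then show ?case using covers_even[of "F t" "F (Suc t)" m] step by simp
        qed (use F in simp)
        have "F t \<in> grid_sphere N n" if "t \<le> n" for t
        proof -
          have "F t \<in> grid_sphere N m" using F that by (auto simp: G_def flags_def m_def grid_hemisphere_def)
          then show ?thesis using z[OF that] N(2) unfolding grid_sphere_def m_def
            by (auto simp: le_Suc_eq) (metis Suc_lessI)
        qed
        then have "F(m := (\<lambda>_. 0)) \<in> flags (grid_sphere N n) n"
          using F(1) by (auto simp: G_def flags_def m_def less_Suc_eq)
        then show "F(m := (\<lambda>_. 0)) \<in> flags (grid_sphere N n) n \<and>
            (\<forall>t\<le>n. \<epsilon> ((F(m := (\<lambda>_. 0))) t) \<longleftrightarrow> even t)"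
          using F(2) unfolding EA by (auto simp: m_def)
      qed
      show "(\<lambda>F. F(m := (F n)(m := 1))) ` ?B \<subseteq> ?A"
      proof clarify
        fix F assume F: "F \<in> flags (grid_sphere N n) n" "\<forall>t\<le>n. \<epsilon> (F t) \<longleftrightarrow> even t"
        have sp: "F t \<in> grid_sphere N n" if "t \<le> n" for t using F that by (auto simp: flags_def)
        have z: "F t m = 0" if "t \<le> n" for t using sp[OF that] by (auto simp: grid_sphere_def m_def)
        have H: "F t \<in> grid_hemisphere N m" if "t \<le> n" for t
          using sp[OF that] z[OF that] N by (auto simp: grid_hemisphere_def grid_sphere_def m_def le_Suc_eq)
        have "(F n)(m := 1) \<in> grid_hemisphere N m"
        proof -
          obtain i where i: "i \<le> n" "\<bar>F n i\<bar> = N" using sp[OF le_refl] by (auto simp: grid_sphere_def)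
          have "\<exists>k\<le>m. \<bar>((F n)(m := 1)) k\<bar> = N" using i by (intro exI[of _ i]) (auto simp: m_def)
          moreover have "\<forall>k\<le>m. \<bar>((F n)(m := 1)) k\<bar> \<le> N" "\<forall>k>m. ((F n)(m := 1)) k = 0"
            using sp[OF le_refl] N by (auto simp: grid_sphere_def m_def le_Suc_eq)
          ultimately show ?thesis unfolding grid_hemisphere_def grid_sphere_def by simp
        qed
        moreover have "covers (F n) ((F n)(m := 1))"
          unfolding covers_def using z[OF le_refl] by (intro exI[of _ m] exI[of _ 1]) auto
        ultimately have "F(m := (F n)(m := 1)) \<in> flags (grid_hemisphere N m) m"
          using F(1) H by (auto simp: flags_def m_def less_Suc_eq le_Suc_eq)
        then show "F(m := (F n)(m := 1)) \<in> G \<and> E (F(m := (F n)(m := 1))) m \<and> (F(m := (F n)(m := 1))) n m = 0"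
          using F(2) z unfolding EA G_def by (auto simp: m_def)
      qed
    qed
  qed
  have "odd (card {F \<in> S. \<forall>t\<le>m. b F t}) \<longleftrightarrow> odd (card {F \<in> G. E F m \<and> F n m = 0})"
    unfolding e1 e2 e3 e4 e5 e7 e8 using e6 e9 by simp
  then show ?case using Suc unfolding e10 S_def b_def unfolding m_def by simp
qed

section \<open>Equivariant maps from spheres have bounded dimension\<close>

definition sphere_points :: "nat \<Rightarrow> (nat \<Rightarrow> real) set" where
  "sphere_points d = {x. (\<Sum>i\<le>d. (x i)\<^sup>2) = 1 \<and> (\<forall>i>d. x i = 0)}"

lemma realize_map_bit_complement:
  "realize_map bit_complement p = (\<lambda>v. p (bit_complement v))"
proof
  fix w
  have inv: "bit_complement (bit_complement v) = v" for v
    by (simp add: bit_complement_def comp_def)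
  have "{v. p v \<noteq> 0 \<and> bit_complement v = w} = (if p (bit_complement w) \<noteq> 0 then {bit_complement w} else {})"
    using inv by auto
  then show "realize_map bit_complement p w = p (bit_complement w)"
    by (simp add: realize_map_def)
qed

text \<open>
  Both product topologies are the topologies of the type classes, so that continuity on a set can be
  used from here on.
\<close>

lemma equivariant_sphere_map_iff:
  "equivariant_sphere_map d K bit_complement f \<longleftrightarrow>
     continuous_on (sphere_points d) f \<and> f ` sphere_points d \<subseteq> realization_points K \<and>
     (\<forall>x\<in>sphere_points d. f (\<lambda>i. - x i) = (\<lambda>v. f x (bit_complement v)))"
proof -
  have "nsphere d = top_of_set (sphere_points d)"
    unfolding nsphere sphere_points_def euclidean_product_topology ..
  moreover have "realization K = top_of_set (realization_points K)"
    unfolding realization_def euclidean_product_topology ..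
  ultimately show ?thesis
    unfolding equivariant_sphere_map_def realize_map_bit_complement
    by (simp add: image_subset_iff_funcset conj_assoc)
qed

lemma finite_cube_vertices: "finite (cube_vertices n)" and card_cube_vertices: "card (cube_vertices n) = 2 ^ n"
  using finite_lists_length_eq[of "UNIV :: bool set" n] card_lists_length_eq[of "UNIV :: bool set" n]
  by (simp_all add: cube_vertices_def)

lemma hamming_dist_bit_complement: "hamming_dist v (bit_complement v) = length v"
proof -
  have "{i. i < length v \<and> v ! i \<noteq> bit_complement v ! i} = {..<length v}"
    by (auto simp: bit_complement_def)
  then show ?thesis by (simp add: hamming_dist_def)
qed

lemma hamming_dist_bit_complement_both:
  "length v = length w \<Longrightarrow> hamming_dist (bit_complement v) (bit_complement w) = hamming_dist v w"
  unfolding hamming_dist_def by (rule arg_cong[where f = card]) (auto simp: bit_complement_def)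

text \<open>
  The vertices with positive coordinate on all of a closed cell form a set \<open>\<phi> w\<close> that decreases
  along a flag; an alternating flag forces it to decrease strictly, from at most \<open>2^n\<close> elements to at least one.
\<close>

theorem equivariant_sphere_map_VR_cube_bound:
  assumes f: "equivariant_sphere_map d (VR_cube n k) bit_complement f" and "k < n"
  shows "d < 2 ^ n"
proof -
  define V where "V = cube_vertices n"
  have V: "finite V" "card V = 2 ^ n"
    using finite_cube_vertices card_cube_vertices by (auto simp: V_def)
  define B where "B = {u::nat \<Rightarrow> real. (\<forall>i>d. u i = 0) \<and> (\<forall>i\<le>d. \<bar>u i\<bar> \<le> 1) \<and> (\<exists>i\<le>d. \<bar>u i\<bar> = 1)}"
  define nrm where "nrm u = sqrt (\<Sum>i\<le>d. (u i)\<^sup>2)" for u :: "nat \<Rightarrow> real"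
  \<comment> \<open>The sphere map, transported to the boundary of the cube by radial projection.\<close>
  define h where "h u = f (\<lambda>i. u i / nrm u)" for u
  have cf: "continuous_on (sphere_points d) f" and fK: "f ` sphere_points d \<subseteq> realization_points (VR_cube n k)"
    and odd_f: "\<And>x. x \<in> sphere_points d \<Longrightarrow> f (\<lambda>i. - x i) = (\<lambda>v. f x (bit_complement v))"
    using f by (auto simp: equivariant_sphere_map_iff)
  have nrm_pos: "nrm u > 0" if "u \<in> B" for u
  proof -
    from that obtain i where i: "i \<le> d" "\<bar>u i\<bar> = 1" by (auto simp: B_def)
    then have "(u i)\<^sup>2 = 1" by (metis one_power2 power2_abs)
    then have "1 \<le> (\<Sum>i\<le>d. (u i)\<^sup>2)" using member_le_sum[of i "{..d}" "\<lambda>i. (u i)\<^sup>2"] i(1) by simp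
    then show ?thesis by (simp add: nrm_def)
  qed
  have proj: "(\<lambda>i. u i / nrm u) \<in> sphere_points d" if "u \<in> B" for u
  proof -
    have "(\<Sum>i\<le>d. (u i / nrm u)\<^sup>2) = (\<Sum>i\<le>d. (u i)\<^sup>2) / (nrm u)\<^sup>2"
      by (simp add: power_divide sum_divide_distrib)
    also have "\<dots> = 1" using nrm_pos[OF that] by (simp add: nrm_def sum_nonneg)
    finally show ?thesis using that by (simp add: sphere_points_def B_def)
  qed
  have cont_h: "continuous_on B h"
    unfolding h_def
  proof (rule continuous_on_compose2[OF cf])
    show "continuous_on B (\<lambda>u i. u i / nrm u)"
      unfolding nrm_def
      by (intro continuous_on_real_coordinatewise continuous_on_divide continuous_on_real_sqrt continuous_on_sum
          continuous_on_power continuous_on_coord)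
        (use nrm_pos in \<open>force simp: nrm_def\<close>)
  qed (use proj in auto)
  have "compact B"
  proof -
    have "B = {u. \<forall>i. u i \<in> (if i \<le> d then {-1..1} else {0})} \<inter> (\<Union>i\<in>{..d}. {u. u i \<in> {-1, 1}})"
      by (auto simp: B_def abs_le_iff abs_eq_iff' not_le split: if_splits)
    moreover have "compact {u::nat \<Rightarrow> real. \<forall>i. u i \<in> (if i \<le> d then {-1..1} else {0})}"
      by (rule compact_product_fun) auto
    moreover have "closed (\<Union>i\<in>{..d}. {u::nat \<Rightarrow> real. u i \<in> {-1, 1}})"
      by (rule closed_UN) (simp, rule ballI, rule closed_Collect_coordinate, simp)
    ultimately show ?thesis by (simp add: compact_Int_closed)
  qed
  obtain \<delta> where \<delta>: "\<delta> > 0"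
    "\<And>x y v. \<lbrakk>x \<in> B; y \<in> B; \<And>i. \<bar>x i - y i\<bar> \<le> \<delta>; v \<in> V\<rbrakk> \<Longrightarrow> \<bar>h x v - h y v\<bar> < 1 / 2 ^ n"
    using uniformly_continuous_coordinates[OF \<open>compact B\<close> cont_h V(1), of "1 / 2 ^ n"] by auto
  obtain M :: nat where M: "1 / real M < \<delta>" "M > 0"
    using \<delta>(1) by (metis ex_inverse_of_nat_less inverse_eq_divide)
  define N :: int where "N = 2 * int M"
  have N: "even N" "N > 0" using M by (auto simp: N_def)
  have N\<delta>: "1 / real_of_int N \<le> \<delta>"
  proof -
    have "1 / real_of_int N \<le> 1 / real M" using M by (simp add: N_def field_simps)
    then show ?thesis using M by linarith
  qed
  define cl where "cl w = {u \<in> B. \<forall>i. if even (w i) then u i = w i / N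
      else (w i - 1) / N \<le> u i \<and> u i \<le> (w i + 1) / N}" for w :: "nat \<Rightarrow> int"
  have clB: "u \<in> B" if "u \<in> cl w" for u w using that unfolding cl_def by blast
  define \<phi> where "\<phi> w = {v \<in> V. \<forall>u\<in>cl w. h u v > 0}" for w
  define \<iota> where "\<iota> \<sigma> = {v. bit_complement v \<in> \<sigma>}" for \<sigma> :: "bool list set"
  have inv: "bit_complement (bit_complement v) = v" for v
    by (simp add: bit_complement_def comp_def)
  have centre: "(\<lambda>i. w i / N) \<in> cl w" if "w \<in> grid_sphere N d" for w
  proof -
    from that obtain j where j: "j \<le> d" "\<bar>w j\<bar> = N" by (auto simp: grid_sphere_def)
    have bnd: "\<bar>w i\<bar> \<le> N" if "i \<le> d" for i
      using \<open>w \<in> grid_sphere N d\<close> that by (auto simp: grid_sphere_def)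
    have "\<bar>real_of_int (w j) / real_of_int N\<bar> = 1" using j N by (simp flip: of_int_abs)
    moreover have "\<bar>real_of_int (w i) / real_of_int N\<bar> \<le> 1" if "i \<le> d" for i
      using bnd[OF that] N by (simp flip: of_int_abs)
    ultimately have "(\<lambda>i. w i / N) \<in> B" using that j(1) unfolding B_def grid_sphere_def by auto
    then show ?thesis using N by (auto simp: cl_def divide_simps)
  qed
  have cl_mono: "cl w \<subseteq> cl w'" if "covers w w'" for w w'
  proof -
    from that obtain a s where a: "even (w a)" "s = 1 \<or> s = - 1" "w' = w(a := w a + s)"
      by (auto simp: covers_def)
    show ?thesis
    proof
      fix u assume u: "u \<in> cl w"
      then have ua: "u a = w a / N" using a(1) by (auto simp: cl_def)
      have "odd (w' a)" using a by auto
      moreover have "(w' a - 1) / N \<le> u a \<and> u a \<le> (w' a + 1) / N"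
        unfolding ua using a(2,3) N by (auto intro!: divide_right_mono)
      moreover have "\<forall>i. i \<noteq> a \<longrightarrow> w' i = w i" using a(3) by simp
      ultimately show "u \<in> cl w'" using u unfolding cl_def mem_Collect_eq by metis
    qed
  qed
  have \<phi>_mono: "\<phi> w' \<subseteq> \<phi> w" if "covers w w'" for w w'
    using cl_mono[OF that] by (auto simp: \<phi>_def)
  have odd_h: "h (\<lambda>i. - u i) v = h u (bit_complement v)" if "u \<in> B" for u v
  proof -
    have "nrm (\<lambda>i. - u i) = nrm u" by (simp add: nrm_def)
    then show ?thesis using odd_f[OF proj[OF that]] by (simp add: h_def)
  qed
  have cl_neg: "(\<lambda>i. - u i) \<in> cl (\<lambda>i. - w i)" if "u \<in> cl w" for u w
  proof -
    have "(\<lambda>i. - u i) \<in> B" using that by (auto simp: cl_def B_def)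
    moreover have "if even (- w i) then - u i = (- w i) / N
        else (- w i - 1) / N \<le> - u i \<and> - u i \<le> (- w i + 1) / N" for i
    proof -
      have "if even (w i) then u i = w i / N else (w i - 1) / N \<le> u i \<and> u i \<le> (w i + 1) / N"
        using that unfolding cl_def mem_Collect_eq by blast
      moreover have "(- real_of_int (w i) - 1) / N = - ((w i + 1) / N)"
        "(- real_of_int (w i) + 1) / N = - ((w i - 1) / N)" by (simp_all add: diff_divide_distrib add_divide_distrib)
      ultimately show ?thesis by (simp split: if_splits)
    qed
    ultimately show ?thesis unfolding cl_def mem_Collect_eq by blast
  qed
  have \<phi>_neg: "\<phi> (\<lambda>i. - w i) = \<iota> (\<phi> w)" for w
  proof -
    have eq: "(\<forall>u\<in>cl (\<lambda>i. - w i). h u v > 0) \<longleftrightarrow> (\<forall>u\<in>cl w. h u (bit_complement v) > 0)" for v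
    proof
      assume *: "\<forall>u\<in>cl (\<lambda>i. - w i). h u v > 0"
      show "\<forall>u\<in>cl w. h u (bit_complement v) > 0"
      proof
        fix u assume "u \<in> cl w"
        then show "h u (bit_complement v) > 0"
          using *[rule_format, OF cl_neg] odd_h[OF clB] by metis
      qed
    next
      assume *: "\<forall>u\<in>cl w. h u (bit_complement v) > 0"
      show "\<forall>u\<in>cl (\<lambda>i. - w i). h u v > 0"
      proof
        fix u assume u: "u \<in> cl (\<lambda>i. - w i)"
        then have "(\<lambda>i. - u i) \<in> cl w" using cl_neg[OF u] by simp
        then have "h (\<lambda>i. - u i) (bit_complement v) > 0" using * by blast
        then show "h u v > 0" using odd_h[OF clB[OF u], of "bit_complement v"] inv by simp
      qed
    qed
    have "v \<in> V \<longleftrightarrow> bit_complement v \<in> V" for v by (simp add: V_def cube_vertices_def bit_complement_def)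
    then show ?thesis unfolding \<phi>_def \<iota>_def using eq by auto
  qed
  have \<phi>_simplex: "\<phi> w \<noteq> {} \<and> \<phi> w \<in> VR_cube n k" if w: "w \<in> grid_sphere N d" for w
  proof -
    let ?u = "\<lambda>i. w i / N"
    have u: "?u \<in> cl w" "?u \<in> B" using centre[OF w] clB by blast+
    have p: "h ?u \<in> realization_points (VR_cube n k)"
      unfolding h_def using fK proj[OF u(2)] by blast
    then have supp: "{v. h ?u v \<noteq> 0} \<in> VR_cube n k" "\<And>v. h ?u v \<ge> 0" "(\<Sum>v | h ?u v \<noteq> 0. h ?u v) = 1"
      by (auto simp: realization_points_def)
    have "{v. h ?u v \<noteq> 0} \<subseteq> V" using supp(1) by (auto simp: VR_cube_def V_def)
    then have sumV: "(\<Sum>v\<in>V. h ?u v) = 1"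
      using supp(3) V(1) by (metis (mono_tags, lifting) Diff_iff mem_Collect_eq sum.mono_neutral_cong_left)
    have "\<exists>v\<in>V. h ?u v \<ge> 1 / 2 ^ n"
    proof (rule ccontr)
      assume "\<not> ?thesis"
      then have "(\<Sum>v\<in>V. h ?u v) < (\<Sum>v\<in>V. 1 / 2 ^ n)"
        using V by (intro sum_strict_mono) (auto simp: not_le)
      then show False using sumV V by simp
    qed
    then obtain v where v: "v \<in> V" "h ?u v \<ge> 1 / 2 ^ n" by blast
    have "h u v > 0" if "u \<in> cl w" for u
    proof -
      have "\<bar>?u i - u i\<bar> \<le> 1 / N" for i
      proof -
        have "if even (w i) then u i = w i / N else (w i - 1) / N \<le> u i \<and> u i \<le> (w i + 1) / N"
          using that unfolding cl_def mem_Collect_eq by blast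
        then show ?thesis using N by (auto simp: abs_le_iff diff_divide_distrib add_divide_distrib split: if_splits)
      qed
      then have "\<bar>h ?u v - h u v\<bar> < 1 / 2 ^ n"
        using \<delta>(2)[OF u(2) _ _ v(1)] clB[OF that] N\<delta> by (meson order_trans)
      then show ?thesis using v(2) by linarith
    qed
    then have "v \<in> \<phi> w" using v(1) by (simp add: \<phi>_def)
    moreover have "\<phi> w \<subseteq> {v. h ?u v \<noteq> 0}" using u(1) by (force simp: \<phi>_def)
    ultimately show ?thesis using supp(1) by (auto simp: VR_cube_def)
  qed
  have \<iota>_free: "\<iota> \<sigma> \<noteq> \<sigma>" if "\<sigma> \<noteq> {}" "\<sigma> \<in> VR_cube n k" for \<sigma>
  proof
    assume "\<iota> \<sigma> = \<sigma>"
    from \<open>\<sigma> \<noteq> {}\<close> obtain v where v: "v \<in> \<sigma>" by blast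
    then have "bit_complement v \<in> \<sigma>" using \<open>\<iota> \<sigma> = \<sigma>\<close> by (auto simp: \<iota>_def)
    then have "hamming_dist v (bit_complement v) \<le> k" "length v = n"
      using v that(2) by (auto simp: VR_cube_def cube_vertices_def)
    then show False using \<open>k < n\<close> by (simp add: hamming_dist_bit_complement)
  qed
  obtain s where s: "\<And>\<sigma>. \<sigma> \<in> {\<sigma> \<in> VR_cube n k. \<sigma> \<noteq> {}} \<Longrightarrow> s (\<iota> \<sigma>) \<longleftrightarrow> \<not> s \<sigma>"
    by (rule involution_sign[of "{\<sigma> \<in> VR_cube n k. \<sigma> \<noteq> {}}" \<iota>]) (use \<iota>_free in \<open>auto simp: \<iota>_def inv\<close>)
  have "odd (card {F \<in> flags (grid_sphere N d) d. \<forall>t\<le>d. s (\<phi> (F t)) \<longleftrightarrow> even t})"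
  proof (rule odd_card_alternating_flags[where \<epsilon> = "\<lambda>w. s (\<phi> w)", OF N _ le_refl])
    fix w assume "w \<in> grid_sphere N d"
    then show "s (\<phi> (\<lambda>i. - w i)) \<longleftrightarrow> \<not> s (\<phi> w)" using s[of "\<phi> w"] \<phi>_simplex[of w] by (simp only: \<phi>_neg) blast
  qed
  then have "{F \<in> flags (grid_sphere N d) d. \<forall>t\<le>d. s (\<phi> (F t)) \<longleftrightarrow> even t} \<noteq> {}"
    by (metis card.empty even_zero)
  then obtain F where F: "F \<in> flags (grid_sphere N d) d" "\<And>t. t \<le> d \<Longrightarrow> s (\<phi> (F t)) \<longleftrightarrow> even t"
    by blast
  have finite_\<phi>: "finite (\<phi> w)" for w using V by (simp add: \<phi>_def)
  have "card (\<phi> (F t)) + t \<le> 2 ^ n" if "t \<le> d" for t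
    using that
  proof (induction t)
    case 0
    have "\<phi> (F 0) \<subseteq> V" by (auto simp: \<phi>_def)
    then show ?case using V card_mono by fastforce
  next
    case (Suc t)
    have "\<phi> (F (Suc t)) \<subseteq> \<phi> (F t)" using \<phi>_mono F(1) Suc.prems by (auto simp: flags_def)
    moreover have "\<phi> (F (Suc t)) \<noteq> \<phi> (F t)" using F(2)[of t] F(2)[of "Suc t"] Suc.prems by auto
    ultimately have "card (\<phi> (F (Suc t))) < card (\<phi> (F t))"
      using finite_\<phi> by (intro psubset_card_mono) auto
    then show ?case using Suc by simp
  qed
  from this[OF le_refl] have "card (\<phi> (F d)) + d \<le> 2 ^ n" .
  moreover have "card (\<phi> (F d)) > 0"
    using \<phi>_simplex[of "F d"] F(1) finite_\<phi> by (auto simp: flags_def card_gt_0_iff)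
  ultimately show ?thesis by linarith
qed

section \<open>Cubes, clique complexes and carriers\<close>

definition support :: "('v \<Rightarrow> real) \<Rightarrow> 'v set" where
  "support p = {v. p v \<noteq> 0}"

definition clique :: "('v \<Rightarrow> 'v \<Rightarrow> bool) \<Rightarrow> 'v set \<Rightarrow> bool" where
  "clique E \<sigma> \<longleftrightarrow> (\<forall>x\<in>\<sigma>. \<forall>y\<in>\<sigma>. E x y)"

text \<open>
  The realization of the clique complex of the graph \<open>E\<close> on the finite vertex set \<open>W\<close>.
\<close>

definition clique_points :: "('v \<Rightarrow> 'v \<Rightarrow> bool) \<Rightarrow> 'v set \<Rightarrow> ('v \<Rightarrow> real) set" where
  "clique_points E W = {p. (\<forall>v. 0 \<le> p v) \<and> support p \<subseteq> W \<and> clique E (support p) \<and> sum p W = 1}"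

text \<open>
  The faces of the unit cube are indexed by pairs of sets: the first set contains the axes on which the
  coordinate is 1, and outside of the second set it is 0. Hence the axes in the difference are free.
\<close>

definition cell :: "'a set \<times> 'a set \<Rightarrow> ('a \<Rightarrow> real) set" where
  "cell c = {z. \<forall>a. 0 \<le> z a \<and> z a \<le> 1 \<and> (a \<in> fst c \<longrightarrow> z a = 1) \<and> (a \<notin> snd c \<longrightarrow> z a = 0)}"

definition cell_boundary :: "'a set \<times> 'a set \<Rightarrow> ('a \<Rightarrow> real) set" where
  "cell_boundary c = {z \<in> cell c. \<exists>a\<in>snd c - fst c. z a = 0 \<or> z a = 1}"

definition cell_dim :: "'a set \<times> 'a set \<Rightarrow> nat" where
  "cell_dim c = card (snd c - fst c)"

definition is_cell :: "'a set \<times> 'a set \<Rightarrow> bool" where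
  "is_cell c \<longleftrightarrow> finite (snd c) \<and> fst c \<subseteq> snd c"

definition face :: "'a set \<times> 'a set \<Rightarrow> 'a set \<times> 'a set \<Rightarrow> bool" where
  "face c' c \<longleftrightarrow> fst c \<subseteq> fst c' \<and> fst c' \<subseteq> snd c' \<and> snd c' \<subseteq> snd c"

definition fillable :: "('v \<Rightarrow> 'v \<Rightarrow> bool) \<Rightarrow> 'v set \<Rightarrow> 'a set \<times> 'a set \<Rightarrow> bool" where
  "fillable E W c \<longleftrightarrow> (\<forall>f. continuous_on (cell_boundary c) f \<and> f ` cell_boundary c \<subseteq> clique_points E W \<longrightarrow>
     (\<exists>F. continuous_on (cell c) F \<and> F ` cell c \<subseteq> clique_points E W \<and> (\<forall>z\<in>cell_boundary c. F z = f z)))"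

text \<open>
  For vertex sets \<open>A\<close> of at most \<open>t\<close> elements this asks that \<open>A\<close> lies in the star of some vertex of \<open>W\<close>;
  for \<open>t = 0\<close> it says that \<open>W\<close> is nonempty.
\<close>

definition conical :: "('v \<Rightarrow> 'v \<Rightarrow> bool) \<Rightarrow> nat \<Rightarrow> 'v set \<Rightarrow> bool" where
  "conical E t W \<longleftrightarrow> (\<forall>A. A \<subseteq> W \<and> finite A \<and> card A \<le> t \<longrightarrow> (\<exists>w\<in>W. \<forall>a\<in>A. E a w))"

lemma clique_subset: "clique E \<sigma> \<Longrightarrow> \<tau> \<subseteq> \<sigma> \<Longrightarrow> clique E \<tau>"
  by (auto simp: clique_def)

lemma clique_points_convex:
  assumes "p \<in> clique_points E W" "q \<in> clique_points E W" "clique E (support p \<union> support q)" "0 \<le> t" "t \<le> 1"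
  shows "(\<lambda>v. t * p v + (1 - t) * q v) \<in> clique_points E W"
proof -
  have "support (\<lambda>v. t * p v + (1 - t) * q v) \<subseteq> support p \<union> support q"
    by (auto simp: support_def)
  then have "support (\<lambda>v. t * p v + (1 - t) * q v) \<subseteq> W" "clique E (support (\<lambda>v. t * p v + (1 - t) * q v))"
    using assms(1,2) clique_subset[OF assms(3)] by (auto simp: clique_points_def)
  moreover have "(\<Sum>v\<in>W. t * p v + (1 - t) * q v) = t * sum p W + (1 - t) * sum q W"
    by (simp only: sum.distrib sum_distrib_left)
  then have "(\<Sum>v\<in>W. t * p v + (1 - t) * q v) = 1"
    using assms(1,2) by (simp add: clique_points_def)
  moreover have "0 \<le> t * p v + (1 - t) * q v" for v
    using assms by (simp add: clique_points_def)
  ultimately show ?thesis by (simp add: clique_points_def)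
qed

lemma cell_eq_product:
  "cell c = {z. \<forall>a. z a \<in> (if a \<in> fst c then {1} else {0..1}) \<inter> (if a \<in> snd c then {0..1} else {0})}"
  (is "_ = {z. \<forall>a. z a \<in> ?K a}")
proof -
  have "(0 \<le> x \<and> x \<le> 1 \<and> (a \<in> fst c \<longrightarrow> x = 1) \<and> (a \<notin> snd c \<longrightarrow> x = 0)) \<longleftrightarrow> x \<in> ?K a" for a x
    by auto
  then show ?thesis unfolding cell_def by (simp only:)
qed

lemma cell_closed: "closed (cell c)"
proof -
  let ?K = "\<lambda>a. (if a \<in> fst c then {1} else {0..1::real}) \<inter> (if a \<in> snd c then {0..1} else {0})"
  have "closed (?K a)" for a by (rule closed_Int) simp_all
  then have "closed (\<Inter>a. {z. z a \<in> ?K a})"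
    by (intro closed_INT ballI closed_Collect_coordinate)
  moreover have "cell c = (\<Inter>a. {z. z a \<in> ?K a})" unfolding cell_eq_product by blast
  ultimately show ?thesis by (simp only:)
qed

lemma cell_compact: "compact (cell c)"
  unfolding cell_eq_product
proof (rule compact_product_fun)
  fix a show "compact ((if a \<in> fst c then {1} else {0..1::real}) \<inter> (if a \<in> snd c then {0..1} else {0}))"
    by (rule compact_Int) simp_all
qed

lemma cell_boundary_Union:
  "cell_boundary c = \<Union> ((\<lambda>a. cell (insert a (fst c), snd c)) ` (snd c - fst c) \<union>
      (\<lambda>a. cell (fst c, snd c - {a})) ` (snd c - fst c))"
  (is "_ = ?R")
proof
  show "cell_boundary c \<subseteq> ?R"
  proof
    fix z assume "z \<in> cell_boundary c"
    then obtain a where a: "z \<in> cell c" "a \<in> snd c - fst c" "z a = 0 \<or> z a = 1" by (auto simp: cell_boundary_def)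
    then have "z \<in> cell (insert a (fst c), snd c) \<or> z \<in> cell (fst c, snd c - {a})" by (auto simp: cell_def)
    then show "z \<in> ?R" using a(2) by blast
  qed
  show "?R \<subseteq> cell_boundary c" by (auto simp: cell_boundary_def cell_def)
qed

lemma cell_boundary_compact:
  assumes "is_cell c" shows "compact (cell_boundary c)"
proof -
  have "finite (snd c - fst c)" using assms by (auto simp: is_cell_def)
  then show ?thesis unfolding cell_boundary_Union by (intro compact_Union) (auto intro: cell_compact)
qed

text \<open>
  If two maps on the boundary have supports that are jointly cliques, the segments between their
  values stay in the complex. This homotopy fills the outer half of the cube, and an extension of
  the second map fills the inner half. Extendability thus passes along chains of such pairs.
\<close>

lemma extend_across_collar:
  assumes c: "is_cell c" "cell_dim c > 0"
    and f: "continuous_on (cell_boundary c) f" "f ` cell_boundary c \<subseteq> clique_points E W"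
    and h: "continuous_on (cell_boundary c) h" "h ` cell_boundary c \<subseteq> clique_points E W"
    and close: "\<And>z. z \<in> cell_boundary c \<Longrightarrow> clique E (support (f z) \<union> support (h z))"
    and H: "continuous_on (cell c) H" "H ` cell c \<subseteq> clique_points E W" "\<And>z. z \<in> cell_boundary c \<Longrightarrow> H z = h z"
  shows "\<exists>F. continuous_on (cell c) F \<and> F ` cell c \<subseteq> clique_points E W \<and> (\<forall>z\<in>cell_boundary c. F z = f z)"
proof -
  define A where "A = snd c - fst c"
  have A: "finite A" "A \<noteq> {}" using c by (auto simp: A_def is_cell_def cell_dim_def card_gt_0_iff)
  \<comment> \<open>Polar coordinates about the centre of the cube: the radius \<open>s\<close>, the radial projection \<open>u\<close> to the
  boundary, and the dilation \<open>w\<close> of the inner half.\<close>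
  define s where "s z = Max ((\<lambda>a. \<bar>2 * z a - 1\<bar>) ` A)" for z :: "'a \<Rightarrow> real"
  define u where "u z = (\<lambda>a. if a \<in> A then 1/2 + (z a - 1/2) / s z else z a)" for z
  define w where "w z = (\<lambda>a. if a \<in> A then 1/2 + 2 * (z a - 1/2) else z a)" for z :: "'a \<Rightarrow> real"
  define F where "F z = (if s z \<le> 1/2 then H (w z)
      else (\<lambda>v. (2 * s z - 1) * f (u z) v + (1 - (2 * s z - 1)) * h (u z) v))" for z
  have s_ge: "\<bar>2 * z a - 1\<bar> \<le> s z" if "a \<in> A" for a z unfolding s_def using A that by (intro Max_ge) auto
  have s_ex: "\<exists>a\<in>A. s z = \<bar>2 * z a - 1\<bar>" for z
  proof -
    have "s z \<in> (\<lambda>a. \<bar>2 * z a - 1\<bar>) ` A" unfolding s_def by (rule Max_in) (use A in auto)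
    then show ?thesis by blast
  qed
  have cs: "continuous_on S s" for S
    unfolding s_def by (rule continuous_on_Max_real[OF A]) (intro continuous_intros continuous_on_coord)
  have s_le: "s z \<le> 1" if "z \<in> cell c" for z
  proof -
    obtain a where "s z = \<bar>2 * z a - 1\<bar>" using s_ex by blast
    moreover have "0 \<le> z a" "z a \<le> 1" using that by (auto simp: cell_def)
    ultimately show ?thesis by (simp add: abs_le_iff)
  qed
  have s_bd: "s z = 1" if "z \<in> cell_boundary c" for z
  proof -
    from that obtain a where "a \<in> A" "z a = 0 \<or> z a = 1" "z \<in> cell c" by (auto simp: cell_boundary_def A_def)
    then show ?thesis using s_ge[of a z] s_le[of z] by auto
  qed
  have u_bd: "u z \<in> cell_boundary c" if z: "z \<in> cell c" and "s z > 0" for z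
  proof -
    have ab: "\<bar>(z a - 1/2) / s z\<bar> \<le> 1/2" if "a \<in> A" for a
    proof -
      have "\<bar>z a - 1/2\<bar> \<le> s z / 2" using s_ge[OF that, of z] by arith
      then show ?thesis using \<open>s z > 0\<close> by (simp add: field_simps)
    qed
    have "0 \<le> u z a \<and> u z a \<le> 1" for a
    proof (cases "a \<in> A")
      case True
      define x where "x = (z a - 1/2) / s z"
      have "\<bar>x\<bar> \<le> 1/2" using ab[OF True] by (simp only: x_def)
      then show ?thesis using True by (simp add: u_def flip: x_def) arith
    qed (use z in \<open>auto simp: u_def cell_def\<close>)
    then have uc: "u z \<in> cell c" using z by (auto simp: cell_def u_def A_def)
    obtain a where a: "a \<in> A" "s z = \<bar>2 * z a - 1\<bar>" using s_ex by blast
    have "u z a = 0 \<or> u z a = 1"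
      using a \<open>s z > 0\<close> by (cases "2 * z a - 1 \<ge> 0") (auto simp: u_def field_simps abs_if)
    then show ?thesis using uc a(1) by (auto simp: cell_boundary_def A_def)
  qed
  have w_cell: "w z \<in> cell c" if z: "z \<in> cell c" and "s z \<le> 1/2" for z
  proof -
    have "0 \<le> w z a \<and> w z a \<le> 1" for a
      using z s_ge[of a z] \<open>s z \<le> 1/2\<close> by (auto simp: w_def cell_def abs_le_iff)
    then show ?thesis using z by (auto simp: cell_def w_def A_def)
  qed
  have "continuous_on (cell c) F"
    unfolding F_def
  proof (rule continuous_on_cases_le[OF _ _ cs])
    show "continuous_on {t \<in> cell c. s t \<le> 1/2} (\<lambda>z. H (w z))"
    proof (rule continuous_on_compose2[OF H(1)])
      show "continuous_on {t \<in> cell c. s t \<le> 1/2} w"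
      proof (rule continuous_on_real_coordinatewise)
        fix a show "continuous_on {t \<in> cell c. s t \<le> 1/2} (\<lambda>z. w z a)"
          unfolding w_def by (cases "a \<in> A") (auto intro!: continuous_intros continuous_on_coord)
      qed
    qed (use w_cell in auto)
    have u_in: "u ` {t \<in> cell c. 1/2 \<le> s t} \<subseteq> cell_boundary c" using u_bd by force
    have cu: "continuous_on {t \<in> cell c. 1/2 \<le> s t} u"
    proof (rule continuous_on_real_coordinatewise)
      fix a show "continuous_on {t \<in> cell c. 1/2 \<le> s t} (\<lambda>z. u z a)"
        unfolding u_def by (cases "a \<in> A") (auto intro!: continuous_intros continuous_on_coord cs)
    qed
    show "continuous_on {t \<in> cell c. 1/2 \<le> s t} (\<lambda>z v. (2 * s z - 1) * f (u z) v + (1 - (2 * s z - 1)) * h (u z) v)"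
    proof (rule continuous_on_real_coordinatewise)
      fix v
      have "continuous_on {t \<in> cell c. 1/2 \<le> s t} (\<lambda>z. f (u z) v)" "continuous_on {t \<in> cell c. 1/2 \<le> s t} (\<lambda>z. h (u z) v)"
        by (rule continuous_on_product_then_coordinatewise, rule continuous_on_compose2[OF f(1) cu u_in],
            rule continuous_on_product_then_coordinatewise, rule continuous_on_compose2[OF h(1) cu u_in])
      then show "continuous_on {t \<in> cell c. 1/2 \<le> s t} (\<lambda>z. (2 * s z - 1) * f (u z) v + (1 - (2 * s z - 1)) * h (u z) v)"
        by (intro continuous_intros cs)
    qed
    fix z assume z: "z \<in> cell c" "s z = 1/2"
    have "u z = w z" unfolding u_def w_def z(2) by (rule ext) simp
    then show "H (w z) = (\<lambda>v. (2 * s z - 1) * f (u z) v + (1 - (2 * s z - 1)) * h (u z) v)"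
      using H(3)[OF u_bd, of z] z(1) unfolding z(2) by simp
  qed
  moreover have "F z \<in> clique_points E W" if z: "z \<in> cell c" for z
  proof (cases "s z \<le> 1/2")
    case True
    then show ?thesis using w_cell[OF z] H(2) by (auto simp: F_def)
  next
    case False
    then have ub: "u z \<in> cell_boundary c" using u_bd[OF z] by simp
    have "(\<lambda>v. (2 * s z - 1) * f (u z) v + (1 - (2 * s z - 1)) * h (u z) v) \<in> clique_points E W"
      by (rule clique_points_convex) (use False s_le[OF z] f(2) h(2) close ub in auto)
    then show ?thesis using False by (simp only: F_def if_False)
  qed
  moreover have "F z = f z" if "z \<in> cell_boundary c" for z
  proof -
    have "u z = z" using s_bd[OF that] by (auto simp: u_def)
    then show ?thesis using s_bd[OF that] by (simp add: F_def)
  qed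
  ultimately show ?thesis by blast
qed

text \<open>
  The unique face of the cube that has the point in its relative interior.
\<close>

definition min_cell :: "('a \<Rightarrow> real) \<Rightarrow> 'a set \<times> 'a set" where
  "min_cell z = ({a. z a = 1}, {a. z a \<noteq> 0})"

lemma min_cell_face: "z \<in> cell c \<Longrightarrow> face (min_cell z) c"
  by (auto simp: face_def min_cell_def cell_def)

lemma in_min_cell: "z \<in> cell c \<Longrightarrow> z \<in> cell (min_cell z)"
  by (auto simp: min_cell_def cell_def)

lemma face_cell_dim: "is_cell c \<Longrightarrow> face c' c \<Longrightarrow> cell_dim c' \<le> cell_dim c"
  unfolding cell_dim_def by (rule card_mono) (auto simp: is_cell_def face_def)

lemma face_cell_dim_eq: assumes "is_cell c" "face c' c" "cell_dim c' = cell_dim c" shows "c' = c"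
proof -
  have "snd c' - fst c' = snd c - fst c"
    by (rule card_subset_eq) (use assms in \<open>auto simp: is_cell_def face_def cell_dim_def\<close>)
  then have "fst c' = fst c \<and> snd c' = snd c" using assms unfolding is_cell_def face_def by blast
  then show ?thesis by (simp add: prod_eq_iff)
qed

lemma min_cell_boundary: assumes "is_cell c" "z \<in> cell_boundary c" shows "cell_dim (min_cell z) < cell_dim c"
proof -
  have "z \<in> cell c" using assms(2) by (simp add: cell_boundary_def)
  then have "face (min_cell z) c" by (rule min_cell_face)
  moreover have "min_cell z \<noteq> c" using assms by (auto simp: min_cell_def cell_boundary_def)
  ultimately show ?thesis using face_cell_dim face_cell_dim_eq assms(1) by (metis le_neq_implies_less)
qed

lemma min_cell_interior: assumes "z \<in> cell c" "z \<notin> cell_boundary c" shows "min_cell z = c"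
  using assms by (auto simp: min_cell_def cell_boundary_def cell_def prod_eq_iff)

text \<open>
  Construction of a map on a cubical complex with prescribed carriers, one dimension at a time. For
  an involution without fixed cells, the filling is chosen on one cell of each orbit and
  transported to the other, which makes the result equivariant. The alternative, that both
  point maps are the identity, gives the version without symmetry.
\<close>

theorem carrier_extension:
  assumes fin: "finite S" and cells: "\<And>c. c \<in> S \<Longrightarrow> is_cell c"
    and faces: "\<And>c c'. c \<in> S \<Longrightarrow> face c' c \<Longrightarrow> c' \<in> S"
    and mono: "\<And>c c'. c \<in> S \<Longrightarrow> face c' c \<Longrightarrow> clique_points E (\<Phi> c') \<subseteq> clique_points E (\<Phi> c)"
    and fill: "\<And>c. c \<in> S \<Longrightarrow> fillable E (\<Phi> c) c"
    and inv: "\<And>c. c \<in> S \<Longrightarrow> \<iota> c \<in> S" "\<And>c. c \<in> S \<Longrightarrow> \<iota> (\<iota> c) = c" "\<And>c. c \<in> S \<Longrightarrow> cell_dim (\<iota> c) = cell_dim c"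
    and \<theta>: "continuous_on UNIV \<theta>" "\<And>z. min_cell z \<in> S \<Longrightarrow> \<theta> (\<theta> z) = z"
      "\<And>c z. c \<in> S \<Longrightarrow> z \<in> cell c \<Longrightarrow> \<theta> z \<in> cell (\<iota> c)"
      "\<And>c z. c \<in> S \<Longrightarrow> z \<in> cell_boundary c \<Longrightarrow> \<theta> z \<in> cell_boundary (\<iota> c)"
    and T: "continuous_on UNIV T" "\<And>p. T (T p) = p"
      "\<And>c. c \<in> S \<Longrightarrow> T ` clique_points E (\<Phi> c) \<subseteq> clique_points E (\<Phi> (\<iota> c))"
    and free: "(\<forall>c\<in>S. \<iota> c \<noteq> c) \<or> \<theta> = id \<and> T = id"
  obtains g where "\<And>c. c \<in> S \<Longrightarrow> continuous_on (cell c) g"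
    "\<And>c. c \<in> S \<Longrightarrow> g ` cell c \<subseteq> clique_points E (\<Phi> c)"
    "\<And>c z. c \<in> S \<Longrightarrow> z \<in> cell c \<Longrightarrow> g (\<theta> z) = T (g z)"
proof -
  define good where "good j g \<longleftrightarrow> (\<forall>c\<in>S. cell_dim c < j \<longrightarrow> continuous_on (cell c) g \<and>
      g ` cell c \<subseteq> clique_points E (\<Phi> c) \<and> (\<forall>z\<in>cell c. g (\<theta> z) = T (g z)))" for j g
  \<comment> \<open>The predicate \<open>R\<close> selects the cells on which the filling is chosen freely.\<close>
  obtain R where R: "\<theta> = id \<and> T = id \<and> (\<forall>c\<in>S. R c) \<or> (\<forall>c\<in>S. R (\<iota> c) \<longleftrightarrow> \<not> R c)"
  proof (cases "\<theta> = id \<and> T = id")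
    case True
    then show ?thesis using that[of "\<lambda>_. True"] by simp
  next
    case False
    then have "\<forall>c\<in>S. \<iota> c \<noteq> c" using free by blast
    then show ?thesis using involution_sign[of S \<iota>] inv(2) that by metis
  qed
  have "\<exists>g. good j g" for j
  proof (induction j)
    case 0
    then show ?case by (simp add: good_def)
  next
    case (Suc j)
    then obtain g where g: "good j g" by blast
    have min_lower: "min_cell z \<in> S \<and> z \<in> cell (min_cell z)" if "c \<in> S" "z \<in> cell c" for c z
      using faces min_cell_face in_min_cell that by blast
    have "\<exists>e. continuous_on (cell c) e \<and> e ` cell c \<subseteq> clique_points E (\<Phi> c) \<and> (\<forall>z\<in>cell_boundary c. e z = g z)"
      if c: "c \<in> S" "cell_dim c = j" for c
    proof -
      let ?C = "(\<lambda>a. cell (insert a (fst c), snd c)) ` (snd c - fst c) \<union> (\<lambda>a. cell (fst c, snd c - {a})) ` (snd c - fst c)"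
      have ic: "is_cell c" using cells c by blast
      have fc: "face (insert a (fst c), snd c) c \<and> face (fst c, snd c - {a}) c \<and>
          cell_dim (insert a (fst c), snd c) < j \<and> cell_dim (fst c, snd c - {a}) < j" if a: "a \<in> snd c - fst c" for a
      proof -
        have f: "face (insert a (fst c), snd c) c" "face (fst c, snd c - {a}) c"
          using ic a by (auto simp: face_def is_cell_def)
        moreover have "(insert a (fst c), snd c) \<noteq> c" "(fst c, snd c - {a}) \<noteq> c" using a by (auto simp: prod_eq_iff)
        ultimately show ?thesis using face_cell_dim[OF ic] face_cell_dim_eq[OF ic] c(2) by (metis le_neq_implies_less)
      qed
      have "continuous_on (\<Union>U\<in>?C. U) g"
      proof (rule continuous_on_closed_Union)
        show "finite ?C" using ic by (auto simp: is_cell_def)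
        show "\<And>U. U \<in> ?C \<Longrightarrow> closed U" using cell_closed by blast
        show "\<And>U. U \<in> ?C \<Longrightarrow> continuous_on U g" using fc g faces[OF c(1)] unfolding good_def by blast
      qed
      then have "continuous_on (cell_boundary c) g" by (simp only: cell_boundary_Union image_ident)
      moreover have "g ` cell_boundary c \<subseteq> clique_points E (\<Phi> c)"
      proof
        fix p assume "p \<in> g ` cell_boundary c"
        then obtain z where z: "z \<in> cell_boundary c" "p = g z" by blast
        then have zc: "z \<in> cell c" by (auto simp: cell_boundary_def)
        then have "g z \<in> clique_points E (\<Phi> (min_cell z))"
          using min_lower[OF c(1) zc] min_cell_boundary[OF ic z(1)] g c(2) unfolding good_def by blast
        then show "p \<in> clique_points E (\<Phi> c)" using mono[OF c(1) min_cell_face[OF zc]] z(2) by blast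
      qed
      ultimately show ?thesis using fill[OF c(1)] unfolding fillable_def by blast
    qed
    then obtain e where e: "\<And>c. c \<in> S \<Longrightarrow> cell_dim c = j \<Longrightarrow> continuous_on (cell c) (e c)"
      "\<And>c. c \<in> S \<Longrightarrow> cell_dim c = j \<Longrightarrow> e c ` cell c \<subseteq> clique_points E (\<Phi> c)"
      "\<And>c z. c \<in> S \<Longrightarrow> cell_dim c = j \<Longrightarrow> z \<in> cell_boundary c \<Longrightarrow> e c z = g z"
      by metis
    define e' where "e' c = (if R c then e c else (\<lambda>z. T (e (\<iota> c) (\<theta> z))))" for c
    have e'1: "continuous_on (cell c) (e' c)" if c: "c \<in> S" "cell_dim c = j" for c
    proof (cases "R c")
      case False
      have "continuous_on (cell c) (\<lambda>z. e (\<iota> c) (\<theta> z))"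
      proof (rule continuous_on_compose2[OF e(1)[OF inv(1)[OF c(1)]]])
        show "cell_dim (\<iota> c) = j" using inv(3)[OF c(1)] c(2) by simp
        show "continuous_on (cell c) \<theta>" using \<theta>(1) by (rule continuous_on_subset) simp
        show "\<theta> ` cell c \<subseteq> cell (\<iota> c)" using \<theta>(3)[OF c(1)] by blast
      qed
      then have "continuous_on (cell c) (\<lambda>z. T (e (\<iota> c) (\<theta> z)))"
        by (rule continuous_on_compose2[OF T(1)]) auto
      then show ?thesis using False by (simp add: e'_def)
    qed (use e c in \<open>simp add: e'_def\<close>)
    have e'2: "e' c ` cell c \<subseteq> clique_points E (\<Phi> c)" if c: "c \<in> S" "cell_dim c = j" for c
    proof (cases "R c")
      case False
      have "T (e (\<iota> c) (\<theta> z)) \<in> clique_points E (\<Phi> c)" if "z \<in> cell c" for z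
      proof -
        have "e (\<iota> c) (\<theta> z) \<in> clique_points E (\<Phi> (\<iota> c))"
          using e(2)[OF inv(1)[OF c(1)]] inv(3)[OF c(1)] \<theta>(3)[OF c(1) that] c(2) by auto
        then show ?thesis using T(3)[OF inv(1)[OF c(1)]] inv(2)[OF c(1)] by auto
      qed
      then show ?thesis using False by (auto simp: e'_def)
    qed (use e c in \<open>simp add: e'_def\<close>)
    have e'3: "e' c z = g z" if c: "c \<in> S" "cell_dim c = j" and z: "z \<in> cell_boundary c" for c z
    proof (cases "R c")
      case False
      have zc: "z \<in> cell c" using z by (auto simp: cell_boundary_def)
      have "g (\<theta> z) = T (g z)"
        using g min_lower[OF c(1) zc] min_cell_boundary[OF cells[OF c(1)] z] c(2) unfolding good_def by blast
      then show ?thesis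
        using False e(3)[OF inv(1)[OF c(1)] _ \<theta>(4)[OF c(1) z]] inv(3)[OF c(1)] c(2) T(2) by (simp add: e'_def)
    qed (use e c z in \<open>simp add: e'_def\<close>)
    define g' where "g' z = (if cell_dim (min_cell z) < j then g z else e' (min_cell z) z)" for z
    have g'_low: "g' z = g z" if "c \<in> S" "cell_dim c < j" "z \<in> cell c" for c z
      using face_cell_dim[OF cells[OF that(1)] min_cell_face[OF that(3)]] that(2) by (simp add: g'_def)
    have g'_top: "g' z = e' c z" if c: "c \<in> S" "cell_dim c = j" "z \<in> cell c" for c z
    proof (cases "z \<in> cell_boundary c")
      case True
      then show ?thesis using min_cell_boundary[OF cells[OF c(1)] True] c e'3 by (simp add: g'_def)
    next
      case False
      then show ?thesis using min_cell_interior[OF c(3) False] c(2) by (simp add: g'_def)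
    qed
    have "good (Suc j) g'"
      unfolding good_def
    proof (intro ballI impI)
      fix c assume c: "c \<in> S" "cell_dim c < Suc j"
      show "continuous_on (cell c) g' \<and> g' ` cell c \<subseteq> clique_points E (\<Phi> c) \<and> (\<forall>z\<in>cell c. g' (\<theta> z) = T (g' z))"
      proof (cases "cell_dim c < j")
        case True
        then have G: "continuous_on (cell c) g" "g ` cell c \<subseteq> clique_points E (\<Phi> c)" "\<And>z. z \<in> cell c \<Longrightarrow> g (\<theta> z) = T (g z)"
          using g c(1) unfolding good_def by blast+
        have eq: "\<And>z. z \<in> cell c \<Longrightarrow> g' z = g z" using g'_low[OF c(1) True] by blast
        have "\<And>z. z \<in> cell c \<Longrightarrow> g' (\<theta> z) = g (\<theta> z)"
          using g'_low[OF inv(1)[OF c(1)]] inv(3)[OF c(1)] True \<theta>(3)[OF c(1)] by simp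
        then show ?thesis using G eq continuous_on_cong[of "cell c" "cell c" g' g] by (auto simp: image_subset_iff)
      next
        case False
        then have d: "cell_dim c = j" using c(2) by simp
        have eq: "\<And>z. z \<in> cell c \<Longrightarrow> g' z = e' c z" using g'_top[OF c(1) d] by blast
        have "g' (\<theta> z) = T (g' z)" if z: "z \<in> cell c" for z
        proof (cases "\<theta> = id \<and> T = id")
          case True
          then show ?thesis by simp
        next
          case nid: False
          then have Rc: "R (\<iota> c) \<longleftrightarrow> \<not> R c" using R c(1) by blast
          have "\<theta> (\<theta> z) = z" using \<theta>(2) min_lower[OF c(1) z] by blast
          moreover have "g' (\<theta> z) = e' (\<iota> c) (\<theta> z)"
            using g'_top[OF inv(1)[OF c(1)]] inv(3)[OF c(1)] d \<theta>(3)[OF c(1) z] by simp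
          ultimately show ?thesis using Rc eq[OF z] T(2) inv(2)[OF c(1)] by (auto simp: e'_def)
        qed
        then show ?thesis using e'1[OF c(1) d] e'2[OF c(1) d] eq continuous_on_cong[of "cell c" "cell c" g' "e' c"]
          by (auto simp: image_subset_iff)
      qed
    qed
    then show ?case by blast
  qed
  then obtain g where g: "good (Suc (Max (cell_dim ` S))) g" by blast
  have "cell_dim c < Suc (Max (cell_dim ` S))" if "c \<in> S" for c using that fin by (simp add: less_Suc_eq_le)
  then show thesis using that[of g] g unfolding good_def by blast
qed

section \<open>Connectivity from common neighbours\<close>

text \<open>
  The boundary of an \<open>r\<close>-cube is \<open>(r - 1)\<close>-dimensional, so after a small deformation at most \<open>r\<close>
  vertices occur in each support. The proof is a simplicial approximation on a fine grid: \<open>hat g\<close>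
  is the hat function of the grid node \<open>g\<close> in the Freudenthal triangulation. The nodes with positive value at a point are
  determined by the sets \<open>U g\<close> of coordinates rounded up; these sets form a chain, and no integral
  coordinate (there is one on the boundary) is ever in them, whence at most \<open>r\<close> of them exist.
\<close>

lemma skeletal_approximation:
  fixes f :: "('a::countable \<Rightarrow> real) \<Rightarrow> 'v \<Rightarrow> real"
  assumes c: "is_cell c" "cell_dim c > 0" and W: "finite W"
    and f: "continuous_on (cell_boundary c) f" "f ` cell_boundary c \<subseteq> clique_points E W"
  obtains f' where "continuous_on (cell_boundary c) f'" "f' ` cell_boundary c \<subseteq> clique_points E W"
    "\<And>z. z \<in> cell_boundary c \<Longrightarrow> support (f' z) \<subseteq> support (f z)"
    "\<And>z. z \<in> cell_boundary c \<Longrightarrow> card (support (f' z)) \<le> cell_dim c"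
proof -
  define A where "A = snd c - fst c"
  have A: "finite A" "A \<noteq> {}" "card A = cell_dim c"
    using c by (auto simp: A_def is_cell_def cell_dim_def card_gt_0_iff)
  obtain a0 where a0: "a0 \<in> A" using A by blast
  have "(\<lambda>a. if a \<in> fst c then 1 else 0) \<in> cell_boundary c"
    using c a0 by (auto simp: cell_boundary_def cell_def is_cell_def A_def intro!: bexI[of _ a0])
  then obtain p0 where "p0 \<in> clique_points E W" using f(2) by blast
  then have "W \<noteq> {}" by (auto simp: clique_points_def)
  then have cW: "card W > 0" using W by (simp add: card_gt_0_iff)
  have big: "\<exists>v\<in>W. p v \<ge> 1 / card W" if p: "p \<in> clique_points E W" for p
  proof (rule ccontr)
    assume "\<not> ?thesis"
    then have "sum p W < (\<Sum>v\<in>W. 1 / card W)" using W \<open>W \<noteq> {}\<close> by (intro sum_strict_mono) (auto simp: not_le)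
    then show False using p cW by (simp add: clique_points_def)
  qed
  have "1 / real (card W) > 0" using cW by simp
  then obtain \<delta> where \<delta>: "\<delta> > 0" "\<And>x y v. \<lbrakk>x \<in> cell_boundary c; y \<in> cell_boundary c; \<And>i. \<bar>x i - y i\<bar> \<le> \<delta>; v \<in> W\<rbrakk>
      \<Longrightarrow> \<bar>f x v - f y v\<bar> < 1 / card W"
    using uniformly_continuous_coordinates[OF cell_boundary_compact[OF c(1)] f(1) W] by metis
  obtain M :: nat where M: "1 / real M < \<delta>" "M > 0"
    using \<delta>(1) by (metis ex_inverse_of_nat_less inverse_eq_divide)
  define Gr where "Gr = (A \<rightarrow>\<^sub>E {0..int M})"
  have finGr: "finite Gr" unfolding Gr_def using A by (intro finite_PiE) auto
  define pos where "pos g z = Max ((\<lambda>a. max 0 (M * z a - real_of_int (g a))) ` A)" for g :: "'a \<Rightarrow> int" and z :: "'a \<Rightarrow> real"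
  define neg where "neg g z = Max ((\<lambda>a. max 0 (real_of_int (g a) - M * z a)) ` A)" for g :: "'a \<Rightarrow> int" and z :: "'a \<Rightarrow> real"
  define hat where "hat g z = max 0 (1 - pos g z - neg g z)" for g z
  define node where "node g = (\<lambda>a. if a \<in> A then real_of_int (g a) / M else if a \<in> fst c then 1 else 0)" for g :: "'a \<Rightarrow> int"
  have "\<exists>v. v \<in> W \<and> (node g \<in> cell_boundary c \<longrightarrow> f (node g) v \<ge> 1 / card W)" for g
    using \<open>W \<noteq> {}\<close> big f(2) by blast
  then obtain lab where lab: "\<And>g. lab g \<in> W" "\<And>g. node g \<in> cell_boundary c \<Longrightarrow> f (node g) (lab g) \<ge> 1 / card W"
    by metis
  have pos_ge: "max 0 (M * z a - g a) \<le> pos g z" if "a \<in> A" for a and g :: "'a \<Rightarrow> int" and z :: "'a \<Rightarrow> real"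
    unfolding pos_def using A that by (intro Max_ge) auto
  have neg_ge: "max 0 (g a - M * z a) \<le> neg g z" if "a \<in> A" for a and g :: "'a \<Rightarrow> int" and z :: "'a \<Rightarrow> real"
    unfolding neg_def using A that by (intro Max_ge) auto
  have pos_neg: "M * z a - g a + (g b - M * z b) < 1" "M * z a - g a < 1" "g a - M * z a < 1"
    if "hat g z > 0" "a \<in> A" "b \<in> A" for a b and g :: "'a \<Rightarrow> int" and z :: "'a \<Rightarrow> real"
  proof -
    have h: "pos g z + neg g z < 1" using that(1) by (simp add: hat_def max_def split: if_splits)
    have "M * z a - g a \<le> pos g z" "0 \<le> pos g z" using pos_ge[OF that(2), of z g] by simp_all
    moreover have "g b - M * z b \<le> neg g z" "0 \<le> neg g z" using neg_ge[OF that(3), of g z] by simp_all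
    moreover have "g a - M * z a \<le> neg g z" using neg_ge[OF that(2), of g z] by simp
    ultimately show "M * z a - g a + (g b - M * z b) < 1" "M * z a - g a < 1" "g a - M * z a < 1"
      using h by linarith+
  qed
  have node_bd: "node g \<in> cell_boundary c \<and> (\<forall>i. \<bar>node g i - z i\<bar> \<le> \<delta>) \<and> (\<exists>a\<in>A. g a = M * z a)"
    if z: "z \<in> cell_boundary c" and g: "g \<in> Gr" "hat g z > 0" for g :: "'a \<Rightarrow> int" and z :: "'a \<Rightarrow> real"
  proof -
    have gM: "0 \<le> g a \<and> g a \<le> int M" if "a \<in> A" for a using g that by (auto simp: Gr_def PiE_def Pi_def)
    have nA: "0 \<le> node g a \<and> node g a \<le> 1" for a
      using gM[of a] M by (auto simp: node_def divide_le_eq)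
    then have nc: "node g \<in> cell c"
      using c(1) unfolding cell_def mem_Collect_eq by (auto simp: node_def A_def is_cell_def)
    from z obtain a where a: "a \<in> A" "z a = 0 \<or> z a = 1" by (auto simp: cell_boundary_def A_def)
    then have "real_of_int (g a) = M * z a"
    proof -
      have "\<bar>real_of_int (g a) - M * z a\<bar> < 1" using pos_neg[OF g(2) a(1) a(1)] by linarith
      moreover have "M * z a = real_of_int 0 \<or> M * z a = real_of_int (int M)" using a(2) by auto
      ultimately show ?thesis
        by (smt (verit, best) of_int_eq_iff of_int_less_iff of_int_diff of_int_1)
    qed
    then have "node g a = z a" using a(1) M by (simp add: node_def)
    then have "node g \<in> cell_boundary c" using nc a by (auto simp: cell_boundary_def A_def)
    moreover have "\<bar>node g i - z i\<bar> \<le> \<delta>" for i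
    proof (cases "i \<in> A")
      case True
      have "\<bar>real_of_int (g i) - M * z i\<bar> < 1" using pos_neg[OF g(2) True True] by linarith
      moreover have "node g i - z i = (real_of_int (g i) - M * z i) / M" using True M by (simp add: node_def field_simps)
      ultimately have "\<bar>node g i - z i\<bar> \<le> 1 / M" using M by (simp add: divide_right_mono)
      then show ?thesis using M(1) by linarith
    next
      case False
      then have "node g i = z i" using z c(1) by (auto simp: node_def A_def cell_boundary_def cell_def is_cell_def)
      then show ?thesis using \<delta>(1) by simp
    qed
    ultimately show ?thesis using a(1) \<open>real_of_int (g a) = M * z a\<close> by blast
  qed
  define tot where "tot z = (\<Sum>g\<in>Gr. hat g z)" for z
  have hat_nn: "0 \<le> hat g z" for g z by (simp add: hat_def)
  have tot_pos: "tot z > 0" if z: "z \<in> cell_boundary c" for z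
  proof -
    define g where "g = (\<lambda>a\<in>A. \<lfloor>M * z a\<rfloor>)"
    have z01: "0 \<le> z a \<and> z a \<le> 1" for a using z by (auto simp: cell_boundary_def cell_def)
    have "\<lfloor>M * z a\<rfloor> \<le> int M" "0 \<le> \<lfloor>M * z a\<rfloor>" for a
    proof -
      have "M * z a \<le> real M" using z01[of a] by (simp add: mult_left_le)
      then show "\<lfloor>M * z a\<rfloor> \<le> int M" by (metis floor_mono floor_of_nat)
      show "0 \<le> \<lfloor>M * z a\<rfloor>" using z01[of a] by simp
    qed
    then have "g \<in> Gr" by (auto simp: g_def Gr_def)
    moreover have "hat g z > 0"
    proof -
      have "neg g z \<le> 0" unfolding neg_def using A by (subst Max_le_iff) (auto simp: g_def)
      moreover have "pos g z < 1" unfolding pos_def using A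
        by (subst Max_less_iff) (auto simp: g_def, linarith)
      ultimately show ?thesis by (simp add: hat_def)
    qed
    ultimately show ?thesis unfolding tot_def using finGr hat_nn by (intro sum_pos2)
  qed
  define f' where "f' z = (\<lambda>v. (\<Sum>g\<in>{g \<in> Gr. lab g = v}. hat g z) / tot z)" for z
  have supp: "support (f' z) \<subseteq> lab ` {g \<in> Gr. hat g z > 0}" for z
  proof
    fix v assume "v \<in> support (f' z)"
    then have "(\<Sum>g\<in>{g \<in> Gr. lab g = v}. hat g z) \<noteq> 0" by (auto simp: support_def f'_def)
    then obtain g where "g \<in> Gr" "lab g = v" "hat g z \<noteq> 0" by (metis (mono_tags, lifting) mem_Collect_eq sum.neutral)
    then show "v \<in> lab ` {g \<in> Gr. hat g z > 0}" using hat_nn[of g z] by force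
  qed
  have s1: "support (f' z) \<subseteq> support (f z)" if z: "z \<in> cell_boundary c" for z
  proof
    fix v assume "v \<in> support (f' z)"
    then obtain g where g: "g \<in> Gr" "hat g z > 0" "v = lab g" using supp by blast
    have n: "node g \<in> cell_boundary c" "\<And>i. \<bar>node g i - z i\<bar> \<le> \<delta>" using node_bd[OF z g(1,2)] by auto
    have "\<bar>f (node g) v - f z v\<bar> < 1 / card W" using \<delta>(2)[OF n(1) z n(2)] lab(1) g(3) by simp
    moreover have "f (node g) v \<ge> 1 / card W" using lab(2)[OF n(1)] g(3) by simp
    ultimately have "f z v > 0" by linarith
    then show "v \<in> support (f z)" by (simp add: support_def)
  qed
  have s2: "card (support (f' z)) \<le> cell_dim c" if z: "z \<in> cell_boundary c" for z
  proof -
    let ?G = "{g \<in> Gr. hat g z > 0}"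
    define U where "U g = {a \<in> A. real_of_int (g a) > M * z a}" for g :: "'a \<Rightarrow> int"
    have val: "g a = (if a \<in> U g then \<lfloor>M * z a\<rfloor> + 1 else \<lfloor>M * z a\<rfloor>)" if "g \<in> ?G" "a \<in> A" for g :: "'a \<Rightarrow> int" and a
    proof -
      have "M * z a - g a < 1" "g a - M * z a < 1" using pos_neg[of g z a a] that by auto
      then show ?thesis using that(2) by (auto simp: U_def; linarith)
    qed
    have chain: "U g \<subseteq> U g' \<or> U g' \<subseteq> U g" if g: "g \<in> ?G" "g' \<in> ?G" for g g'
    proof (rule ccontr)
      assume "\<not> ?thesis"
      then obtain a b where ab: "a \<in> U g" "a \<notin> U g'" "b \<in> U g'" "b \<notin> U g" by blast
      then have "a \<in> A" "b \<in> A" by (auto simp: U_def)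
      then have "M * z b - g b + (g a - M * z a) < 1" "M * z a - g' a + (g' b - M * z b) < 1"
        using pos_neg(1)[of g z b a] pos_neg(1)[of g' z a b] g by auto
      then show False using val[OF g(1) \<open>a \<in> A\<close>] val[OF g(1) \<open>b \<in> A\<close>] val[OF g(2) \<open>a \<in> A\<close>] val[OF g(2) \<open>b \<in> A\<close>] ab
        by simp
    qed
    have finU: "finite (U g)" for g using A by (simp add: U_def)
    have "inj_on (\<lambda>g. card (U g)) ?G"
    proof (rule inj_onI)
      fix g g' assume g: "g \<in> ?G" "g' \<in> ?G" "card (U g) = card (U g')"
      then have "U g = U g'" using chain[OF g(1,2)] finU by (metis card_subset_eq)
      then have "g a = g' a" if "a \<in> A" for a using val[OF g(1) that] val[OF g(2) that] by simp
      then show "g = g'" using g(1,2) by (intro PiE_ext[of g A _ g']) (auto simp: Gr_def)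
    qed
    moreover have "(\<lambda>g. card (U g)) ` ?G \<subseteq> {..<cell_dim c}"
    proof (rule image_subsetI)
      fix g assume "g \<in> ?G"
      then obtain a where "a \<in> A" "g a = M * z a" using node_bd[OF z] by blast
      then have "a \<in> A - U g" by (simp add: U_def)
      moreover have "U g \<subseteq> A" by (auto simp: U_def)
      ultimately have "U g \<subset> A" by blast
      then show "card (U g) \<in> {..<cell_dim c}" using psubset_card_mono[OF A(1)] A(3) by simp
    qed
    ultimately have "card ?G \<le> cell_dim c" by (metis card_inj_on_le card_lessThan finite_lessThan)
    moreover have "card (support (f' z)) \<le> card ?G"
      using supp[of z] finGr by (intro surj_card_le) auto
    ultimately show ?thesis by linarith
  qed
  have "f' z \<in> clique_points E W" if z: "z \<in> cell_boundary c" for z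
  proof -
    have fz: "f z \<in> clique_points E W" using f(2) z by blast
    have "support (f z) \<subseteq> W" "clique E (support (f z))" using fz by (auto simp: clique_points_def)
    then have "support (f' z) \<subseteq> W" "clique E (support (f' z))" using s1[OF z] clique_subset by auto
    moreover have "sum (f' z) W = (\<Sum>v\<in>W. \<Sum>g\<in>{g \<in> Gr. lab g = v}. hat g z) / tot z"
      unfolding f'_def by (rule sum_divide_distrib[symmetric])
    then have "sum (f' z) W = 1"
    proof -
      have "(\<Sum>v\<in>W. \<Sum>g\<in>{g \<in> Gr. lab g = v}. hat g z) = tot z"
        unfolding tot_def by (rule sum.group[OF finGr W]) (use lab(1) in blast)
      then show ?thesis using tot_pos[OF z] \<open>sum (f' z) W = _\<close> by simp
    qed
    moreover have "0 \<le> f' z v" for v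
      using hat_nn tot_pos[OF z] by (simp add: f'_def sum_nonneg)
    ultimately show ?thesis by (simp add: clique_points_def)
  qed
  moreover have "continuous_on (cell_boundary c) f'"
  proof -
    have ch: "continuous_on S (hat g)" for S g
      unfolding hat_def pos_def neg_def
      by (intro continuous_on_max continuous_on_diff continuous_on_const continuous_on_Max_real A(1,2)
          continuous_on_mult continuous_on_coord)
    show ?thesis
      unfolding f'_def tot_def
      by (intro continuous_on_real_coordinatewise continuous_on_divide continuous_on_sum ch)
        (use tot_pos in \<open>force simp: tot_def\<close>)
  qed
  ultimately show thesis using that s1 s2 by blast
qed

lemma clique_points_mono:
  assumes "W' \<subseteq> W" "finite W" shows "clique_points E W' \<subseteq> clique_points E W"
proof
  fix p assume p: "p \<in> clique_points E W'"
  then have "sum p W = sum p W'"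
    using assms by (intro sum.mono_neutral_right) (auto simp: clique_points_def support_def)
  then show "p \<in> clique_points E W" using p assms by (auto simp: clique_points_def)
qed

definition common_neighbours :: "('v \<Rightarrow> 'v \<Rightarrow> bool) \<Rightarrow> 'v set \<Rightarrow> 'v set \<Rightarrow> 'v set" where
  "common_neighbours E W B = {w \<in> W. \<forall>b\<in>B. E b w}"

text \<open>
  Spending \<open>card B\<close> of the allowance on \<open>B\<close> itself.
\<close>

lemma conical_common_neighbours:
  assumes "conical E t W" "B \<subseteq> W" "finite B" "s + card B \<le> t"
  shows "conical E s (common_neighbours E W B)"
  unfolding conical_def
proof (intro allI impI)
  fix A assume A: "A \<subseteq> common_neighbours E W B \<and> finite A \<and> card A \<le> s"
  then have "A \<union> B \<subseteq> W \<and> finite (A \<union> B) \<and> card (A \<union> B) \<le> t"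
    using assms card_Un_le[of A B] by (auto simp: common_neighbours_def)
  then obtain w where "w \<in> W" "\<forall>a\<in>A \<union> B. E a w" using assms(1) unfolding conical_def by blast
  then show "\<exists>w\<in>common_neighbours E W B. \<forall>a\<in>A. E a w" by (auto simp: common_neighbours_def)
qed

text \<open>
  Fix a vertex \<open>w0\<close>. The given map is deformed to a constant in four steps, each of which keeps the supports
  jointly cliques: to a map \<open>f1\<close> with supports of at most \<open>r\<close> vertices, where \<open>r\<close> is the dimension of the cube; to the map \<open>f2\<close> that keeps
  only the vertices whose coordinate exceeds half the maximum; to a map \<open>f3\<close>
  into common neighbours of these vertices and of \<open>w0\<close>; and to the constant \<open>w0\<close>. For the third map, rescale the coordinates so that
  half the maximum becomes 1. The simplices of dimension less than \<open>r\<close> turn into faces \<open>(\<tau>, \<sigma>)\<close> of a cube with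
  nonempty \<open>\<tau>\<close>, of dimension \<open>card \<sigma> - card \<tau> < r\<close>, and the common neighbours of \<open>\<tau>\<close> and \<open>w0\<close>
  are a carrier to which the induction hypothesis applies, because
  \<open>2 * (card \<sigma> - card \<tau>) + card \<tau> + 1 \<le> 2 * r\<close>.
\<close>

lemma conical_fillable_step:
  fixes E :: "'v \<Rightarrow> 'v \<Rightarrow> bool" and c :: "'a::countable set \<times> 'a set"
  assumes refl: "\<And>x. E x x" and sym: "\<And>x y. E x y \<Longrightarrow> E y x"
    and IH: "\<And>W' (c' :: 'v set \<times> 'v set). is_cell c' \<Longrightarrow> cell_dim c' < cell_dim c \<Longrightarrow> finite W' \<Longrightarrow>
      conical E (2 * cell_dim c') W' \<Longrightarrow> fillable E W' c'"
    and c: "is_cell c" and W: "finite W" "conical E (2 * cell_dim c) W"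
  shows "fillable E W c"
  unfolding fillable_def
proof (intro allI impI)
  fix f assume "continuous_on (cell_boundary c) f \<and> f ` cell_boundary c \<subseteq> clique_points E W"
  then have f: "continuous_on (cell_boundary c) f" "f ` cell_boundary c \<subseteq> clique_points E W" by auto
  obtain w0 where w0: "w0 \<in> W" using W(2) unfolding conical_def by (metis card.empty empty_subsetI finite.emptyI le0)
  define f4 where "f4 = (\<lambda>(z::'a \<Rightarrow> real) v. if v = w0 then 1 else 0 :: real)"
  have f4_supp: "support (f4 z) = {w0}" for z by (auto simp: f4_def support_def)
  have f4: "f4 z \<in> clique_points E W" for z
  proof -
    have "sum (f4 z) W = 1" "\<forall>v. 0 \<le> f4 z v" using w0 W(1) by (simp_all add: f4_def)
    then show ?thesis using w0 refl by (simp add: clique_points_def f4_supp clique_def)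
  qed
  have f4_cont: "continuous_on X f4" for X unfolding f4_def by (intro continuous_on_const)
  show "\<exists>F. continuous_on (cell c) F \<and> F ` cell c \<subseteq> clique_points E W \<and> (\<forall>z\<in>cell_boundary c. F z = f z)"
  proof (cases "cell_dim c = 0")
    case True
    then have "cell_boundary c = {}" using c by (auto simp: cell_boundary_def cell_dim_def is_cell_def)
    then show ?thesis using f4 f4_cont by (intro exI[of _ f4]) auto
  next
    case False
    then have pos: "cell_dim c > 0" by simp
    define l where "l = cell_dim c"
    obtain f1 where f1: "continuous_on (cell_boundary c) f1" "f1 ` cell_boundary c \<subseteq> clique_points E W"
      "\<And>z. z \<in> cell_boundary c \<Longrightarrow> support (f1 z) \<subseteq> support (f z)"
      "\<And>z. z \<in> cell_boundary c \<Longrightarrow> card (support (f1 z)) \<le> l"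
      using skeletal_approximation[OF c pos W(1) f] unfolding l_def by metis
    define S where "S = {d :: 'v set \<times> 'v set. fst d \<noteq> {} \<and> fst d \<subseteq> snd d \<and> snd d \<subseteq> W \<and> clique E (snd d) \<and> card (snd d) \<le> l}"
    define \<Phi> where "\<Phi> d = common_neighbours E W (insert w0 (fst d))" for d :: "'v set \<times> 'v set"
    have finS: "finite S"
      by (rule finite_subset[of _ "Pow W \<times> Pow W"]) (use W(1) in \<open>auto simp: S_def\<close>)
    have \<Phi>W: "\<Phi> d \<subseteq> W" for d by (auto simp: \<Phi>_def common_neighbours_def)
    obtain g where g: "\<And>d. d \<in> S \<Longrightarrow> continuous_on (cell d) g" "\<And>d. d \<in> S \<Longrightarrow> g ` cell d \<subseteq> clique_points E (\<Phi> d)"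
    proof (rule carrier_extension[of S E \<Phi> id id id])
      show "finite S" by (fact finS)
      fix d assume d: "d \<in> S"
      then have "snd d \<subseteq> W" "fst d \<subseteq> W" by (auto simp: S_def)
      then have fd: "finite (snd d)" "finite (fst d)" using W(1) finite_subset by blast+
      then show ic: "is_cell d" using d by (auto simp: S_def is_cell_def)
      show "fillable E (\<Phi> d) d"
      proof (rule IH[OF ic])
        have "card (fst d) > 0" using d fd by (auto simp: S_def card_gt_0_iff)
        moreover have "card (fst d) \<le> card (snd d)" using d fd by (auto simp: S_def intro: card_mono)
        moreover have dd: "cell_dim d = card (snd d) - card (fst d)"
          using d fd by (simp add: cell_dim_def S_def card_Diff_subset)
        moreover have "card (snd d) \<le> l" using d by (simp add: S_def)
        ultimately have ineq: "cell_dim d < cell_dim c" "2 * cell_dim d + (card (fst d) + 1) \<le> 2 * cell_dim c"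
          unfolding l_def by linarith+
        show "cell_dim d < cell_dim c" by (fact ineq(1))
        show "finite (\<Phi> d)" using finite_subset[OF \<Phi>W W(1)] .
        show "conical E (2 * cell_dim d) (\<Phi> d)"
          unfolding \<Phi>_def
        proof (rule conical_common_neighbours[OF W(2)])
          show "insert w0 (fst d) \<subseteq> W" using w0 d by (auto simp: S_def)
          show "finite (insert w0 (fst d))" using fd by simp
          show "2 * cell_dim d + card (insert w0 (fst d)) \<le> 2 * cell_dim c"
            using ineq(2) card_insert_le_m1[of "card (fst d) + 1" "fst d" w0] by simp
        qed
      qed
      fix d' assume d': "face d' d"
      then have "fst d' \<noteq> {}" "card (snd d') \<le> card (snd d)" using d fd by (auto simp: face_def S_def intro: card_mono)
      then show "d' \<in> S" using d d' clique_subset[of E "snd d" "snd d'"] by (auto simp: face_def S_def)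
      have "\<Phi> d' \<subseteq> \<Phi> d" using d' by (auto simp: \<Phi>_def common_neighbours_def face_def)
      then show "clique_points E (\<Phi> d') \<subseteq> clique_points E (\<Phi> d)"
        using clique_points_mono finite_subset[OF \<Phi>W W(1)] by blast
    qed (auto simp: continuous_on_id id_def)
    \<comment> \<open>The coordinates of \<open>\<zeta> y\<close> that equal 1 belong to the vertices with at least half the maximal
  coordinate of \<open>y\<close>, which include the support of the value of \<open>f2\<close>.\<close>
    define mx where "mx y = Max (y ` W)" for y :: "'v \<Rightarrow> real"
    define \<zeta> where "\<zeta> y = (\<lambda>v. min 1 (2 * y v / mx y))" for y :: "'v \<Rightarrow> real"
    have mx_cont: "continuous_on X mx" for X
    proof -
      have "W \<noteq> {}" using w0 by blast
      then have "continuous_on X (\<lambda>y. Max ((\<lambda>v. y v) ` W))"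
        by (intro continuous_on_Max_real W(1) continuous_on_coord)
      then show ?thesis unfolding mx_def[abs_def] .
    qed
    have mx_ge: "y v \<le> mx y" if "v \<in> W" for v and y :: "'v \<Rightarrow> real" unfolding mx_def using W(1) that by simp
    have mx_ex: "\<exists>v\<in>W. mx y = y v" for y :: "'v \<Rightarrow> real"
    proof -
      have "mx y \<in> y ` W" unfolding mx_def by (rule Max_in) (use W(1) w0 in auto)
      then show ?thesis by blast
    qed
    have mx_pos: "mx y > 0" if "y \<in> clique_points E W" for y
    proof (rule ccontr)
      assume "\<not> mx y > 0"
      then have "y v \<le> 0" if "v \<in> W" for v using mx_ge[OF that, of y] by linarith
      then have "sum y W \<le> 0" by (rule sum_nonpos)
      then show False using that by (simp add: clique_points_def)
    qed
    have \<zeta>_cell: "min_cell (\<zeta> y) \<in> S \<and> \<zeta> y \<in> cell (min_cell (\<zeta> y)) \<and> fst (min_cell (\<zeta> y)) = {v. mx y \<le> 2 * y v}"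
      if y: "y \<in> clique_points E W" "card (support y) \<le> l" for y
    proof -
      have nn: "0 \<le> y v" for v using y by (simp add: clique_points_def)
      have s: "snd (min_cell (\<zeta> y)) = support y"
        using mx_pos[OF y(1)] by (auto simp: min_cell_def \<zeta>_def support_def min_def)
      have t: "fst (min_cell (\<zeta> y)) = {v. mx y \<le> 2 * y v}"
        using mx_pos[OF y(1)] by (auto simp: min_cell_def \<zeta>_def min_def field_simps)
      obtain v where "v \<in> W" "mx y = y v" using mx_ex by blast
      then have "v \<in> fst (min_cell (\<zeta> y))" using nn[of v] t by simp
      moreover have "fst (min_cell (\<zeta> y)) \<subseteq> snd (min_cell (\<zeta> y))" by (auto simp: min_cell_def)
      ultimately have "min_cell (\<zeta> y) \<in> S"
        using y s by (auto simp: S_def clique_points_def)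
      moreover have "0 \<le> \<zeta> y v \<and> \<zeta> y v \<le> 1" for v using nn[of v] mx_pos[OF y(1)] by (simp add: \<zeta>_def)
      then have "\<zeta> y \<in> cell (min_cell (\<zeta> y))" by (simp add: cell_def min_cell_def)
      ultimately show ?thesis using t by blast
    qed
    have f1y: "f1 z \<in> clique_points E W" "card (support (f1 z)) \<le> l" if "z \<in> cell_boundary c" for z
      using f1 that by auto
    have mxf: "continuous_on (cell_boundary c) (\<lambda>z. mx (f1 z))"
      by (rule continuous_on_compose2[OF mx_cont f1(1)]) auto
    have f1v: "continuous_on (cell_boundary c) (\<lambda>z. f1 z v)" for v
      by (rule continuous_on_product_then_coordinatewise[OF f1(1)])
    define f3 where "f3 z = g (\<zeta> (f1 z))" for z
    have f3_\<Phi>: "f3 z \<in> clique_points E (\<Phi> (min_cell (\<zeta> (f1 z))))" if "z \<in> cell_boundary c" for z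
      using \<zeta>_cell[OF f1y[OF that]] g(2) unfolding f3_def by blast
    have f3: "f3 ` cell_boundary c \<subseteq> clique_points E W"
      using f3_\<Phi> clique_points_mono[OF \<Phi>W W(1)] by blast
    have g_cont: "continuous_on (\<Union>d\<in>S. cell d) g"
      by (rule continuous_on_closed_Union[OF finS cell_closed g(1)])
    have f3_cont: "continuous_on (cell_boundary c) f3"
      unfolding f3_def
    proof (rule continuous_on_compose2[OF g_cont])
      show "continuous_on (cell_boundary c) (\<lambda>z. \<zeta> (f1 z))"
        unfolding \<zeta>_def
        by (intro continuous_on_real_coordinatewise continuous_on_min continuous_on_divide continuous_on_mult
            continuous_on_const mxf f1v) (use mx_pos f1y in force)
      show "(\<lambda>z. \<zeta> (f1 z)) ` cell_boundary c \<subseteq> (\<Union>d\<in>S. cell d)" using \<zeta>_cell f1y by blast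
    qed
    define nf where "nf z = (\<Sum>v\<in>W. max 0 (2 * f1 z v - mx (f1 z)))" for z
    define f2 where "f2 z = (\<lambda>v. max 0 (2 * f1 z v - mx (f1 z)) / nf z)" for z
    have nf_pos: "nf z > 0" if z: "z \<in> cell_boundary c" for z
    proof -
      obtain v where "v \<in> W" "mx (f1 z) = f1 z v" using mx_ex by blast
      then show ?thesis unfolding nf_def using mx_pos[OF f1y(1)[OF z]] W(1)
        by (intro sum_pos2[of W v]) auto
    qed
    have f2_supp: "support (f2 z) \<subseteq> {v. mx (f1 z) \<le> 2 * f1 z v}" "support (f2 z) \<subseteq> support (f1 z)"
      if z: "z \<in> cell_boundary c" for z
      using mx_pos[OF f1y(1)[OF z]] by (auto simp: support_def f2_def max_def split: if_splits)
    have f2: "f2 ` cell_boundary c \<subseteq> clique_points E W"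
    proof clarify
      fix z assume z: "z \<in> cell_boundary c"
      have "support (f1 z) \<subseteq> W" "clique E (support (f1 z))" using f1y(1)[OF z] by (auto simp: clique_points_def)
      then have "support (f2 z) \<subseteq> W" "clique E (support (f2 z))" using f2_supp(2)[OF z] clique_subset by auto
      moreover have "sum (f2 z) W = 1" using nf_pos[OF z] by (simp add: f2_def nf_def flip: sum_divide_distrib)
      moreover have "0 \<le> f2 z v" for v using nf_pos[OF z] by (simp add: f2_def)
      ultimately show "f2 z \<in> clique_points E W" by (simp add: clique_points_def)
    qed
    have f2_cont: "continuous_on (cell_boundary c) f2"
      unfolding f2_def nf_def
      by (intro continuous_on_real_coordinatewise continuous_on_divide continuous_on_max continuous_on_sum
          continuous_on_diff continuous_on_mult continuous_on_const mxf f1v)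
        (use nf_pos in \<open>force simp: nf_def\<close>)
    have ff4: "f4 ` cell_boundary c \<subseteq> clique_points E W" using f4 by blast
    note collar = extend_across_collar[OF c pos]
    obtain F3 where F3: "continuous_on (cell c) F3" "F3 ` cell c \<subseteq> clique_points E W" "\<And>z. z \<in> cell_boundary c \<Longrightarrow> F3 z = f3 z"
    proof -
      have "\<exists>F. continuous_on (cell c) F \<and> F ` cell c \<subseteq> clique_points E W \<and> (\<forall>z\<in>cell_boundary c. F z = f3 z)"
      proof (rule collar[OF f3_cont f3 f4_cont ff4 _ f4_cont _ HOL.refl])
        fix z assume z: "z \<in> cell_boundary c"
        have "clique E (support (f3 z))" "\<forall>v\<in>support (f3 z). E w0 v"
          using f3_\<Phi>[OF z] by (auto simp: clique_points_def \<Phi>_def common_neighbours_def)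
        then show "clique E (support (f3 z) \<union> support (f4 z))"
          unfolding f4_supp using refl sym by (auto simp: clique_def)
      qed (use f4 in auto)
      then show thesis using that by blast
    qed
    obtain F2 where F2: "continuous_on (cell c) F2" "F2 ` cell c \<subseteq> clique_points E W" "\<And>z. z \<in> cell_boundary c \<Longrightarrow> F2 z = f2 z"
    proof -
      have "\<exists>F. continuous_on (cell c) F \<and> F ` cell c \<subseteq> clique_points E W \<and> (\<forall>z\<in>cell_boundary c. F z = f2 z)"
      proof (rule collar[OF f2_cont f2 f3_cont f3 _ F3])
        fix z assume z: "z \<in> cell_boundary c"
        have "support (f2 z) \<subseteq> fst (min_cell (\<zeta> (f1 z)))" using f2_supp(1)[OF z] \<zeta>_cell[OF f1y[OF z]] by simp
        then have "\<forall>t\<in>support (f2 z). \<forall>v\<in>support (f3 z). E t v"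
          using f3_\<Phi>[OF z] by (auto simp: clique_points_def \<Phi>_def common_neighbours_def)
        moreover have "clique E (support (f3 z))" "clique E (support (f2 z))"
          using f2 f3 z by (auto simp: clique_points_def)
        ultimately show "clique E (support (f2 z) \<union> support (f3 z))" using sym by (auto simp: clique_def)
      qed
      then show thesis using that by blast
    qed
    obtain F1 where F1: "continuous_on (cell c) F1" "F1 ` cell c \<subseteq> clique_points E W" "\<And>z. z \<in> cell_boundary c \<Longrightarrow> F1 z = f1 z"
    proof -
      have "\<exists>F. continuous_on (cell c) F \<and> F ` cell c \<subseteq> clique_points E W \<and> (\<forall>z\<in>cell_boundary c. F z = f1 z)"
      proof (rule collar[OF f1(1,2) f2_cont f2 _ F2])
        fix z assume z: "z \<in> cell_boundary c"
        have "support (f1 z) \<union> support (f2 z) = support (f1 z)" using f2_supp(2)[OF z] by blast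
        then show "clique E (support (f1 z) \<union> support (f2 z))" using f1y(1)[OF z] by (simp add: clique_points_def)
      qed
      then show thesis using that by blast
    qed
    show ?thesis
    proof (rule collar[OF f f1(1,2) _ F1])
      fix z assume z: "z \<in> cell_boundary c"
      have "support (f z) \<union> support (f1 z) = support (f z)" using f1(3)[OF z] by blast
      then show "clique E (support (f z) \<union> support (f1 z))" using f(2) z by (auto simp: clique_points_def)
    qed
  qed
qed

text \<open>
  The induction needs cubes whose axes are the vertices of the graph, whatever the axes of the given
  cube are; therefore it is run for such cubes, and the step is applied once more at the end.
\<close>

theorem conical_fillable:
  fixes E :: "'v::countable \<Rightarrow> 'v \<Rightarrow> bool" and c :: "'a::countable set \<times> 'a set"
  assumes refl: "\<And>x. E x x" and sym: "\<And>x y. E x y \<Longrightarrow> E y x"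
    and c: "is_cell c" and W: "finite W" "conical E (2 * cell_dim c) W"
  shows "fillable E W c"
proof -
  have main: "fillable E W' d" if "cell_dim d = r" "is_cell d" "finite W'" "conical E (2 * cell_dim d) W'"
    for r and d :: "'v set \<times> 'v set" and W'
    using that
  proof (induction r arbitrary: d W' rule: less_induct)
    case (less r)
    show ?case
    proof (rule conical_fillable_step[OF refl sym _ less.prems(2,3,4)])
      fix W'' and d' :: "'v set \<times> 'v set"
      assume "is_cell d'" "cell_dim d' < cell_dim d" "finite W''" "conical E (2 * cell_dim d') W''"
      then show "fillable E W'' d'" using less.IH[of "cell_dim d'" d' W''] less.prems(1) by blast
    qed
  qed
  show ?thesis
    by (rule conical_fillable_step[OF refl _ main[OF HOL.refl] c W]) (rule sym)
qed

section \<open>Maps into the faces of the vertex cube\<close>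

definition cube_faces :: "nat \<Rightarrow> nat \<Rightarrow> (nat set \<times> nat set) set" where
  "cube_faces n D = {c. fst c \<subseteq> snd c \<and> snd c \<subseteq> {..<n} \<and> cell_dim c \<le> D}"

definition face_vertices :: "nat \<Rightarrow> nat set \<times> nat set \<Rightarrow> bool list set" where
  "face_vertices n c = {v \<in> cube_vertices n. \<forall>i<n. (i \<in> fst c \<longrightarrow> v ! i) \<and> (i \<notin> snd c \<longrightarrow> \<not> v ! i)}"

text \<open>
  The comparison of lengths makes the relation symmetric on all lists.
\<close>

definition near :: "nat \<Rightarrow> bool list \<Rightarrow> bool list \<Rightarrow> bool" where
  "near k x y \<longleftrightarrow> length x = length y \<and> hamming_dist x y \<le> k"

definition cube_complement :: "nat \<Rightarrow> (nat \<Rightarrow> real) \<Rightarrow> nat \<Rightarrow> real" where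
  "cube_complement n z = (\<lambda>i. if i < n then 1 - z i else 0)"

lemma near_refl: "near k x x"
  by (simp add: near_def hamming_dist_def)

lemma near_sym: "near k x y \<Longrightarrow> near k y x"
proof -
  assume a: "near k x y"
  then have "{i. i < length y \<and> y ! i \<noteq> x ! i} = {i. i < length x \<and> x ! i \<noteq> y ! i}" by (auto simp: near_def)
  then have "hamming_dist y x = hamming_dist x y" by (simp only: hamming_dist_def)
  then show ?thesis using a by (simp add: near_def)
qed

text \<open>
  Chernoff's bound: weight every subset \<open>U\<close> by \<open>x ^ card U\<close>.
\<close>

lemma card_large_subsets_bound:
  fixes x :: real
  assumes "finite F" "x \<ge> 1"
  shows "card {U. U \<subseteq> F \<and> k < card U} * x ^ (k + 1) \<le> (1 + x) ^ card F"
proof -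
  have "card {U. U \<subseteq> F \<and> k < card U} * x ^ (k + 1) = (\<Sum>U\<in>{U. U \<subseteq> F \<and> k < card U}. x ^ (k + 1))"
    by simp
  also have "\<dots> \<le> (\<Sum>U\<in>{U. U \<subseteq> F \<and> k < card U}. x ^ card U)"
    using assms(2) by (intro sum_mono power_increasing) auto
  also have "\<dots> \<le> (\<Sum>U\<in>Pow F. x ^ card U)"
    using assms by (intro sum_mono2) auto
  also have "\<dots> = (1 + x) ^ card F"
    using prod_add[OF assms(1), of "\<lambda>_. x" "\<lambda>_. 1"] by (simp add: add.commute)
  finally show ?thesis .
qed

text \<open>
  Union bound. A vertex of the face is given by a subset of the free coordinates, and it is far from
  a given vertex of the face if its symmetric difference with the corresponding subset is large.
\<close>

lemma face_vertices_conical: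
  assumes c: "fst c \<subseteq> snd c" "snd c \<subseteq> {..<n}"
    and few: "2 * cell_dim c * card {U. U \<subseteq> snd c - fst c \<and> k < card U} < 2 ^ cell_dim c"
  shows "conical (near k) (2 * cell_dim c) (face_vertices n c)"
  unfolding conical_def
proof (intro allI impI)
  fix A assume A: "A \<subseteq> face_vertices n c \<and> finite A \<and> card A \<le> 2 * cell_dim c"
  define F where "F = snd c - fst c"
  have finF: "finite F" unfolding F_def by (rule finite_subset[of _ "{..<n}"]) (use c in auto)
  define X where "X a = {i \<in> F. a ! i}" for a :: "bool list"
  \<comment> \<open>The vertex of the face that corresponds to the set \<open>Y\<close> of free coordinates.\<close>
  define vt where "vt Y = map (\<lambda>i. i \<in> fst c \<or> i \<in> Y) [0..<n]" for Y :: "nat set"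
  have vt_face: "vt Y \<in> face_vertices n c" if "Y \<subseteq> F" for Y
    using that c by (auto simp: vt_def face_vertices_def cube_vertices_def F_def)
  have dist: "hamming_dist a (vt Y) = card (sym_diff (X a) Y)" if "a \<in> face_vertices n c" "Y \<subseteq> F" for a Y
  proof -
    have "{i. i < length a \<and> a ! i \<noteq> vt Y ! i} = sym_diff (X a) Y"
    proof (rule Set.set_eqI)
      fix i
      show "i \<in> {i. i < length a \<and> a ! i \<noteq> vt Y ! i} \<longleftrightarrow> i \<in> sym_diff (X a) Y"
      proof (cases "i < n")
        case True
        have a: "length a = n" "i \<in> fst c \<Longrightarrow> a ! i" "i \<notin> snd c \<Longrightarrow> \<not> a ! i"
          using that(1) True by (auto simp: face_vertices_def cube_vertices_def)
        have v: "vt Y ! i \<longleftrightarrow> i \<in> fst c \<or> i \<in> Y" using True by (simp add: vt_def)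
        show ?thesis using a v True that(2) c by (auto simp: X_def F_def)
      next
        case False
        then have "i \<notin> F" using c by (auto simp: F_def)
        then show ?thesis using that False by (auto simp: X_def face_vertices_def cube_vertices_def)
      qed
    qed
    then show ?thesis by (simp add: hamming_dist_def)
  qed
  define Bad where "Bad a = {Y. Y \<subseteq> F \<and> k < card (sym_diff (X a) Y)}" for a
  have XF: "X a \<subseteq> F" for a by (auto simp: X_def)
  have card_Bad: "card (Bad a) = card {U. U \<subseteq> F \<and> k < card U}" for a
  proof (rule bij_betw_same_card)
    have invol: "sym_diff (X a) (sym_diff (X a) Y) = Y" for Y by blast
    show "bij_betw (sym_diff (X a)) (Bad a) {U. U \<subseteq> F \<and> k < card U}"
      by (rule bij_betw_byWitness[where f' = "sym_diff (X a)"]) (use XF[of a] in \<open>auto simp: Bad_def invol\<close>)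
  qed
  have "card (\<Union>a\<in>A. Bad a) \<le> (\<Sum>a\<in>A. card (Bad a))" using A by (intro card_UN_le) auto
  also have "\<dots> \<le> 2 * cell_dim c * card {U. U \<subseteq> F \<and> k < card U}"
    using A by (simp add: card_Bad)
  also have "\<dots> < card (Pow F)" using few finF by (simp add: F_def card_Pow cell_dim_def)
  finally have "card (\<Union>a\<in>A. Bad a) < card (Pow F)" .
  have "\<not> Pow F \<subseteq> (\<Union>a\<in>A. Bad a)"
  proof
    assume sub: "Pow F \<subseteq> (\<Union>a\<in>A. Bad a)"
    have "finite (Bad a)" for a using finF by (simp add: Bad_def)
    then have "finite (\<Union>a\<in>A. Bad a)" using A by blast
    then show False using card_mono[OF _ sub] \<open>card (\<Union>a\<in>A. Bad a) < card (Pow F)\<close> by linarith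
  qed
  then obtain Y where Y: "Y \<subseteq> F" "\<forall>a\<in>A. Y \<notin> Bad a" by blast
  have "near k a (vt Y)" if "a \<in> A" for a
  proof -
    have "a \<in> face_vertices n c" using A that by blast
    then show ?thesis using Y that dist[of a Y]
      by (auto simp: near_def Bad_def face_vertices_def cube_vertices_def vt_def)
  qed
  then show "\<exists>w\<in>face_vertices n c. \<forall>a\<in>A. near k a w" using vt_face[OF Y(1)] by blast
qed

lemma compact_sphere_points: "compact (sphere_points d)"
proof -
  have "compact {x::nat \<Rightarrow> real. \<forall>i. x i \<in> (if i \<le> d then {-1..1} else {0})}"
    by (rule compact_product_fun) auto
  moreover have "closed {x::nat \<Rightarrow> real. (\<Sum>i\<le>d. (x i)\<^sup>2) \<in> {1}}"
  proof -
    have "closed ((\<lambda>x::nat \<Rightarrow> real. \<Sum>i\<le>d. (x i)\<^sup>2) -` {1})"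
      by (rule closed_vimage) (intro closed_singleton continuous_on_sum continuous_on_power continuous_on_coord)+
    then show ?thesis by (simp add: vimage_def)
  qed
  moreover have "sphere_points d = {x. \<forall>i. x i \<in> (if i \<le> d then {-1..1} else {0})} \<inter> {x. (\<Sum>i\<le>d. (x i)\<^sup>2) \<in> {1}}"
  proof -
    have "\<bar>x i\<bar> \<le> 1" if "(\<Sum>i\<le>d. (x i)\<^sup>2) = 1" "i \<le> d" for x :: "nat \<Rightarrow> real" and i
    proof -
      have "(x i)\<^sup>2 \<le> 1" using member_le_sum[of i "{..d}" "\<lambda>i. (x i)\<^sup>2"] that by simp
      then show ?thesis by (simp add: abs_square_le_1)
    qed
    then have in_box: "x i \<in> (if i \<le> d then {-1..1} else {0})" if "x \<in> sphere_points d" for x :: "nat \<Rightarrow> real" and i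
      using that by (cases "i \<le> d") (auto simp: sphere_points_def abs_le_iff)
    have zero: "x i = 0" if "x i \<in> (if i \<le> d then {-1..1} else {0})" "d < i" for x :: "nat \<Rightarrow> real" and i
      using that by simp
    show ?thesis using in_box zero unfolding sphere_points_def by blast
  qed
  ultimately show ?thesis by (simp only: compact_Int_closed)
qed

text \<open>
  A polynomial of degree at most \<open>D\<close> that is not zero has at most \<open>D\<close> zeros. By compactness of the sphere of coefficients,
  there is \<open>\<eta> > 0\<close> such that at most \<open>D\<close> of the values at \<open>0, ..., n - 1\<close> are smaller than \<open>\<eta>\<close> in absolute value;
  clamping at \<open>\<eta>\<close> leaves only those coordinates strictly between 0 and 1.
\<close>

lemma sphere_to_skeleton:
  assumes "D < n"
  obtains G where "continuous_on (sphere_points D) G"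
    "\<And>x. x \<in> sphere_points D \<Longrightarrow> min_cell (G x) \<in> cube_faces n D \<and> G x \<in> cell (min_cell (G x))"
    "\<And>x. x \<in> sphere_points D \<Longrightarrow> G (\<lambda>i. - x i) = cube_complement n (G x)"
proof -
  define q where "q x i = (\<Sum>j\<le>D. x j * real i ^ j)" for x :: "nat \<Rightarrow> real" and i :: nat
  have q_cont: "continuous_on X (\<lambda>x. q x i)" for X i
    unfolding q_def by (intro continuous_on_sum continuous_on_mult continuous_on_const continuous_on_coord)
  have q_neg: "q (\<lambda>i. - x i) i = - q x i" for x i by (simp add: q_def sum_negf)
  have roots: "card {i. i < n \<and> q x i = 0} \<le> D" if x: "x \<in> sphere_points D" for x
  proof -
    have "\<exists>j\<le>D. x j \<noteq> 0"
    proof (rule ccontr)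
      assume "\<not> ?thesis"
      then have "(\<Sum>i\<le>D. (x i)\<^sup>2) = 0" by (intro sum.neutral) auto
      then show False using x by (simp add: sphere_points_def)
    qed
    then obtain j where j: "x j \<noteq> 0" "j \<le> D" by blast
    have "real ` {i. i < n \<and> q x i = 0} \<subseteq> {z. (\<Sum>i\<le>D. x i * z ^ i) = 0}" by (auto simp: q_def)
    then have "card (real ` {i. i < n \<and> q x i = 0}) \<le> D"
      using polyfun_roots_card[of x, OF j] polyfun_roots_finite[of x, OF j] card_mono order_trans by blast
    then show ?thesis by (simp add: card_image)
  qed
  define \<A> where "\<A> = {A. A \<subseteq> {..<n} \<and> card A = D + 1}"
  have "\<exists>\<delta>>0. \<forall>x\<in>sphere_points D. \<delta> \<le> (\<Sum>i\<in>A. \<bar>q x i\<bar>)" if A: "A \<in> \<A>" for A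
  proof -
    have "(\<lambda>i. if i = 0 then 1 else 0) \<in> sphere_points D"
      by (simp add: sphere_points_def if_distrib[of "\<lambda>t. t\<^sup>2"] cong: if_cong)
    then have ne: "sphere_points D \<noteq> {}" by blast
    have "continuous_on (sphere_points D) (\<lambda>x. \<Sum>i\<in>A. \<bar>q x i\<bar>)"
      by (intro continuous_on_sum continuous_on_rabs q_cont)
    then obtain y where y: "y \<in> sphere_points D" "\<forall>x\<in>sphere_points D. (\<Sum>i\<in>A. \<bar>q y i\<bar>) \<le> (\<Sum>i\<in>A. \<bar>q x i\<bar>)"
      using continuous_attains_inf[OF compact_sphere_points ne] by blast
    have finA: "finite A" by (rule finite_subset[of _ "{..<n}"]) (use A in \<open>auto simp: \<A>_def\<close>)
    have "(\<Sum>i\<in>A. \<bar>q y i\<bar>) > 0"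
    proof (rule ccontr)
      assume "\<not> ?thesis"
      moreover have "(\<Sum>i\<in>A. \<bar>q y i\<bar>) \<ge> 0" by (intro sum_nonneg) simp
      ultimately have "(\<Sum>i\<in>A. \<bar>q y i\<bar>) = 0" by linarith
      then have "A \<subseteq> {i. i < n \<and> q y i = 0}"
        using A finA by (auto simp: sum_nonneg_eq_0_iff \<A>_def)
      then have "card A \<le> card {i. i < n \<and> q y i = 0}" by (intro card_mono) auto
      then show False using roots[OF y(1)] A by (simp add: \<A>_def)
    qed
    then show ?thesis using y(2) by blast
  qed
  then obtain dl where dl: "\<And>A. A \<in> \<A> \<Longrightarrow> dl A > (0::real)"
    "\<And>A x. A \<in> \<A> \<Longrightarrow> x \<in> sphere_points D \<Longrightarrow> dl A \<le> (\<Sum>i\<in>A. \<bar>q x i\<bar>)" by metis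
  define \<eta> where "\<eta> = Min (insert 1 (dl ` \<A>)) / (D + 1)"
  have fin\<A>: "finite \<A>" unfolding \<A>_def by (rule finite_subset[of _ "Pow {..<n}"]) auto
  have \<eta>_pos: "\<eta> > 0" unfolding \<eta>_def using fin\<A> dl(1) by (auto simp: Min_gr_iff)
  have \<eta>_le: "(D + 1) * \<eta> \<le> dl A" if "A \<in> \<A>" for A
  proof -
    have "Min (insert 1 (dl ` \<A>)) \<le> dl A" using fin\<A> that by (intro Min_le) auto
    then show ?thesis by (simp add: \<eta>_def)
  qed
  have small: "card {i. i < n \<and> \<bar>q x i\<bar> < \<eta>} \<le> D" if x: "x \<in> sphere_points D" for x
  proof (rule ccontr)
    assume "\<not> ?thesis"
    then have "D + 1 \<le> card {i. i < n \<and> \<bar>q x i\<bar> < \<eta>}" by simp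
    then obtain A where A: "A \<subseteq> {i. i < n \<and> \<bar>q x i\<bar> < \<eta>}" "card A = D + 1"
      by (metis obtain_subset_with_card_n)
    then have "A \<in> \<A>" by (auto simp: \<A>_def)
    have "(\<Sum>i\<in>A. \<bar>q x i\<bar>) < (\<Sum>i\<in>A. \<eta>)"
    proof (rule sum_strict_mono)
      show "finite A" using A(2) card.infinite by fastforce
      show "A \<noteq> {}" using A(2) by auto
    qed (use A(1) in auto)
    also have "\<dots> \<le> dl A" using \<eta>_le[OF \<open>A \<in> \<A>\<close>] A(2) by simp
    finally show False using dl(2)[OF \<open>A \<in> \<A>\<close> x] by simp
  qed
  define G where "G x = (\<lambda>i. if i < n then min 1 (max 0 ((1 + q x i / \<eta>) / 2)) else 0)" for x
  show thesis
  proof (rule that[of G])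
    show "continuous_on (sphere_points D) G"
    proof (rule continuous_on_real_coordinatewise)
      fix i show "continuous_on (sphere_points D) (\<lambda>x. G x i)"
        unfolding G_def by (cases "i < n") (auto intro!: continuous_intros q_cont simp: less_imp_neq[OF \<eta>_pos, symmetric])
    qed
  next
    fix x assume x: "x \<in> sphere_points D"
    show "G (\<lambda>i. - x i) = cube_complement n (G x)"
      by (rule ext) (auto simp: G_def cube_complement_def q_neg min_def max_def field_simps)
    have "snd (min_cell (G x)) - fst (min_cell (G x)) \<subseteq> {i. i < n \<and> \<bar>q x i\<bar> < \<eta>}"
    proof
      fix i assume "i \<in> snd (min_cell (G x)) - fst (min_cell (G x))"
      then have G: "G x i \<noteq> 0" "G x i \<noteq> 1" by (auto simp: min_cell_def)
      then have "i < n" by (auto simp: G_def split: if_splits)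
      then have "- 1 < q x i / \<eta>" "q x i / \<eta> < 1"
        using G by (auto simp: G_def min_def max_def split: if_splits)
      then show "i \<in> {i. i < n \<and> \<bar>q x i\<bar> < \<eta>}"
        using \<open>i < n\<close> \<eta>_pos by (auto simp: field_simps abs_less_iff)
    qed
    then have "cell_dim (min_cell (G x)) \<le> card {i. i < n \<and> \<bar>q x i\<bar> < \<eta>}"
      unfolding cell_dim_def by (intro card_mono) auto
    then have "cell_dim (min_cell (G x)) \<le> D" using small[OF x] by linarith
    moreover have "snd (min_cell (G x)) \<subseteq> {..<n}" by (auto simp: min_cell_def G_def split: if_splits)
    moreover have "fst (min_cell (G x)) \<subseteq> snd (min_cell (G x))" by (auto simp: min_cell_def)
    moreover have "0 \<le> G x i \<and> G x i \<le> 1" for i by (simp add: G_def)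
    ultimately show "min_cell (G x) \<in> cube_faces n D \<and> G x \<in> cell (min_cell (G x))"
      unfolding cube_faces_def by (simp add: cell_def min_cell_def)
  qed
qed

text \<open>
  A face of the cube is carried by the vertices on it. No proper face is its own complement, which is what makes the
  cellwise construction equivariant.
\<close>

theorem equivariant_sphere_map_exists:
  assumes "D < n" and con: "\<And>c. c \<in> cube_faces n D \<Longrightarrow> conical (near k) (2 * cell_dim c) (face_vertices n c)"
  shows "\<exists>f. equivariant_sphere_map D (VR_cube n k) bit_complement f"
proof -
  let ?S = "cube_faces n D" and ?\<Phi> = "face_vertices n"
  define \<iota> where "\<iota> c = ({..<n} - snd c, {..<n} - fst c)" for c :: "nat set \<times> nat set"
  define T where "T p = (\<lambda>v. p (bit_complement v))" for p :: "bool list \<Rightarrow> real"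
  have comp2: "bit_complement (bit_complement v) = v" for v
    by (simp add: bit_complement_def comp_def)
  have fin\<Phi>: "finite (?\<Phi> c)" for c
    by (rule finite_subset[OF _ finite_cube_vertices[of n]]) (auto simp: face_vertices_def)
  have comp_face: "bit_complement v \<in> ?\<Phi> (\<iota> c) \<longleftrightarrow> v \<in> ?\<Phi> c" if "c \<in> ?S" for v c
    using that by (auto simp: face_vertices_def cube_vertices_def bit_complement_def \<iota>_def cube_faces_def)
  obtain g where g: "\<And>c. c \<in> ?S \<Longrightarrow> continuous_on (cell c) g" "\<And>c. c \<in> ?S \<Longrightarrow> g ` cell c \<subseteq> clique_points (near k) (?\<Phi> c)"
    "\<And>c z. c \<in> ?S \<Longrightarrow> z \<in> cell c \<Longrightarrow> g (cube_complement n z) = T (g z)"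
  proof (rule carrier_extension[of ?S "near k" ?\<Phi> \<iota> "cube_complement n" T])
    show "finite ?S"
      by (rule finite_subset[of _ "Pow {..<n} \<times> Pow {..<n}"]) (auto simp: cube_faces_def)
    show "continuous_on UNIV (cube_complement n)"
    proof (rule continuous_on_real_coordinatewise)
      fix i show "continuous_on UNIV (\<lambda>z. cube_complement n z i)"
        unfolding cube_complement_def by (cases "i < n") (auto intro!: continuous_intros continuous_on_coord)
    qed
    show "continuous_on UNIV T"
      unfolding T_def by (intro continuous_on_real_coordinatewise continuous_on_coord)
    show "T (T p) = p" for p by (simp add: T_def comp2)
    show "cube_complement n (cube_complement n z) = z" if "min_cell z \<in> ?S" for z
      using that by (auto simp: cube_complement_def cube_faces_def min_cell_def fun_eq_iff)
    fix c assume c: "c \<in> ?S"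
    show ic: "is_cell c" using c finite_subset[OF _ finite_lessThan] by (auto simp: is_cell_def cube_faces_def)
    show "fillable (near k) (?\<Phi> c) c"
      by (rule conical_fillable[OF near_refl near_sym ic fin\<Phi> con[OF c]])
    show "\<iota> (\<iota> c) = c" using c by (auto simp: \<iota>_def cube_faces_def prod_eq_iff)
    have "snd (\<iota> c) - fst (\<iota> c) = snd c - fst c" using c by (auto simp: \<iota>_def cube_faces_def)
    then show dim: "cell_dim (\<iota> c) = cell_dim c" by (simp add: cell_dim_def)
    show "\<iota> c \<in> ?S" using c dim by (auto simp: \<iota>_def cube_faces_def)
    show "T ` clique_points (near k) (?\<Phi> c) \<subseteq> clique_points (near k) (?\<Phi> (\<iota> c))"
    proof (rule image_subsetI)
      fix p assume p: "p \<in> clique_points (near k) (?\<Phi> c)"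
      have sp: "v \<in> support (T p) \<longleftrightarrow> bit_complement v \<in> support p" for v by (simp add: support_def T_def)
      have "support (T p) \<subseteq> ?\<Phi> (\<iota> c)"
      proof
        fix v assume "v \<in> support (T p)"
        then have "bit_complement v \<in> ?\<Phi> c" using sp p by (auto simp: clique_points_def)
        then show "v \<in> ?\<Phi> (\<iota> c)" using comp_face[OF c, of "bit_complement v"] comp2 by simp
      qed
      moreover have "clique (near k) (support (T p))"
        unfolding clique_def
      proof (intro ballI)
        fix v w assume "v \<in> support (T p)" "w \<in> support (T p)"
        then have "near k (bit_complement v) (bit_complement w)"
          using sp p by (auto simp: clique_points_def clique_def)
        then show "near k v w"
          using hamming_dist_bit_complement_both[of v w] by (simp add: near_def bit_complement_def)
      qed
      moreover have "sum (T p) (?\<Phi> (\<iota> c)) = sum p (?\<Phi> c)"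
        unfolding T_def
        by (rule sum.reindex_bij_witness[of _ bit_complement bit_complement])
          (use comp2 comp_face[OF c] in \<open>auto, metis\<close>)
      ultimately show "T p \<in> clique_points (near k) (?\<Phi> (\<iota> c))"
        using p by (simp add: clique_points_def T_def)
    qed
    show "cube_complement n z \<in> cell (\<iota> c)" if "z \<in> cell c" for z
      using that c by (auto simp: cell_def cube_complement_def \<iota>_def cube_faces_def)
    then show "cube_complement n z \<in> cell_boundary (\<iota> c)" if "z \<in> cell_boundary c" for z
      using that c by (fastforce simp: cell_boundary_def cube_complement_def \<iota>_def cube_faces_def)
    fix c' assume f: "face c' c"
    then have "cell_dim c' \<le> cell_dim c" using face_cell_dim[OF ic] by blast
    then show "c' \<in> ?S" using c f by (auto simp: cube_faces_def face_def)
    have "?\<Phi> c' \<subseteq> ?\<Phi> c" using f by (auto simp: face_vertices_def face_def)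
    then show "clique_points (near k) (?\<Phi> c') \<subseteq> clique_points (near k) (?\<Phi> c)"
      using clique_points_mono fin\<Phi> by blast
  next
    have "\<iota> c \<noteq> c" if c: "c \<in> ?S" for c
    proof
      assume "\<iota> c = c"
      then have e: "{..<n} - snd c = fst c" "{..<n} - fst c = snd c" by (auto simp: \<iota>_def prod_eq_iff)
      then have "fst c = {}" using c by (auto simp: cube_faces_def)
      then have "snd c - fst c = {..<n}" using e by auto
      then have "cell_dim c = n" by (simp add: cell_dim_def)
      then show False using c \<open>D < n\<close> by (simp add: cube_faces_def)
    qed
    then show "(\<forall>c\<in>?S. \<iota> c \<noteq> c) \<or> cube_complement n = id \<and> T = id" by blast
  qed (use that in blast)
  obtain G where G: "continuous_on (sphere_points D) G"
    "\<And>x. x \<in> sphere_points D \<Longrightarrow> min_cell (G x) \<in> ?S \<and> G x \<in> cell (min_cell (G x))"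
    "\<And>x. x \<in> sphere_points D \<Longrightarrow> G (\<lambda>i. - x i) = cube_complement n (G x)"
    using sphere_to_skeleton[OF \<open>D < n\<close>] by blast
  have finS: "finite ?S"
    by (rule finite_subset[of _ "Pow {..<n} \<times> Pow {..<n}"]) (auto simp: cube_faces_def)
  have gc: "continuous_on (\<Union>c\<in>?S. cell c) g"
    by (rule continuous_on_closed_Union[OF finS cell_closed g(1)])
  have "continuous_on (sphere_points D) (\<lambda>x. g (G x))"
    by (rule continuous_on_compose2[OF gc G(1)]) (use G(2) in blast)
  moreover have "(\<lambda>x. g (G x)) ` sphere_points D \<subseteq> realization_points (VR_cube n k)"
  proof (rule image_subsetI)
    fix x assume x: "x \<in> sphere_points D"
    have "g (G x) \<in> clique_points (near k) (?\<Phi> (min_cell (G x)))" using G(2)[OF x] g(2) by blast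
    moreover have "?\<Phi> (min_cell (G x)) \<subseteq> cube_vertices n" by (auto simp: face_vertices_def)
    ultimately have p: "g (G x) \<in> clique_points (near k) (cube_vertices n)"
      using clique_points_mono[OF _ finite_cube_vertices] by blast
    have "{v. g (G x) v \<noteq> 0} \<in> VR_cube n k"
      using p by (auto simp: clique_points_def support_def clique_def near_def VR_cube_def)
    moreover have "(\<Sum>v | g (G x) v \<noteq> 0. g (G x) v) = sum (g (G x)) (cube_vertices n)"
      using p by (intro sum.mono_neutral_left finite_cube_vertices) (auto simp: clique_points_def support_def)
    ultimately show "g (G x) \<in> realization_points (VR_cube n k)"
      using p by (simp add: realization_points_def clique_points_def)
  qed
  moreover have "g (G (\<lambda>i. - x i)) = (\<lambda>v. g (G x) (bit_complement v))" if x: "x \<in> sphere_points D" for x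
  proof -
    have "g (cube_complement n (G x)) = T (g (G x))" using G(2)[OF x] g(3) by blast
    then show ?thesis using G(3)[OF x] by (simp add: T_def)
  qed
  ultimately have "equivariant_sphere_map D (VR_cube n k) bit_complement (\<lambda>x. g (G x))"
    unfolding equivariant_sphere_map_iff by blast
  then show ?thesis by blast
qed

text \<open>
  The hypothesis on \<open>x\<close> is Chernoff's bound for faces of dimension \<open>D\<close>; as \<open>x \<ge> 1\<close>, it
  implies the one for smaller faces.
\<close>

theorem coind_VR_cube_ge:
  fixes x :: real
  assumes "D < n" "k < n" "x \<ge> 1" and D: "2 * real D * ((1 + x) / 2) ^ D < x ^ (k + 1)"
  shows "D \<le> coind_Z2 (VR_cube n k) bit_complement"
proof -
  have "conical (near k) (2 * cell_dim c) (face_vertices n c)" if c: "c \<in> cube_faces n D" for c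
  proof (rule face_vertices_conical)
    show cs: "fst c \<subseteq> snd c" "snd c \<subseteq> {..<n}" using c by (auto simp: cube_faces_def)
    let ?r = "cell_dim c" and ?B = "card {U. U \<subseteq> snd c - fst c \<and> k < card U}"
    have fin: "finite (snd c - fst c)" by (rule finite_subset[of _ "{..<n}"]) (use cs in auto)
    have r: "?r \<le> D" using c by (simp add: cube_faces_def)
    have xp: "x ^ (k + 1) > 0" using \<open>x \<ge> 1\<close> by simp
    have "real (2 * ?r * ?B) * x ^ (k + 1) = 2 * real ?r * (?B * x ^ (k + 1))" by simp
    also have "\<dots> \<le> 2 * real ?r * (1 + x) ^ ?r"
      using card_large_subsets_bound[OF fin \<open>x \<ge> 1\<close>, of k] by (intro mult_left_mono) (auto simp: cell_dim_def)
    also have "\<dots> = 2 * real ?r * ((1 + x) / 2) ^ ?r * 2 ^ ?r" by (simp add: power_divide)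
    also have "\<dots> \<le> 2 * real D * ((1 + x) / 2) ^ D * 2 ^ ?r"
      using r \<open>x \<ge> 1\<close> by (intro mult_right_mono mult_mono power_increasing) auto
    also have "\<dots> < x ^ (k + 1) * 2 ^ ?r" using D by simp
    finally have "real (2 * ?r * ?B) * x ^ (k + 1) < 2 ^ ?r * x ^ (k + 1)" by (simp add: mult.commute)
    then have "real (2 * ?r * ?B) < 2 ^ ?r" using xp by (simp only: mult_less_cancel_right_pos)
    then show "2 * ?r * ?B < 2 ^ ?r" by (metis of_nat_less_iff of_nat_numeral of_nat_power)
  qed
  then have "\<exists>f. equivariant_sphere_map D (VR_cube n k) bit_complement f"
    by (rule equivariant_sphere_map_exists[OF \<open>D < n\<close>])
  then show ?thesis
    unfolding coind_Z2_def
    by (rule Greatest_le_nat[where b = "2 ^ n"])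
      (use equivariant_sphere_map_VR_cube_bound[OF _ \<open>k < n\<close>] less_imp_le in blast)
qed

section \<open>Choice of the dimension\<close>

text \<open>
  Taking \<open>x = 1 + \<delta> k\<close> in Chernoff's bound and comparing logarithms, one may choose \<open>D\<close> as
  \<open>2 * k * (1 - \<delta> k) - 2 * ln (4 * k) / \<delta> k\<close>, rounded down. The relative loss is of order
  \<open>\<delta> k + ln k / (k * \<delta> k)\<close>, which vanishes in the limit for \<open>\<delta> k = k powr (- 1/3)\<close>.
\<close>

theorem lemma5:
  shows "\<exists>\<epsilon> :: nat \<Rightarrow> real. \<epsilon> \<longlonglongrightarrow> 0 \<and>
    (\<forall>k n :: nat. 1 \<le> k \<and> real k < real n / 2 \<longrightarrow>
      real (coind_Z2 (VR_cube n k) bit_complement) \<ge> (1 - \<epsilon> k) * (2 * real k))"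
proof -
  define \<delta> where "\<delta> k = real k powr (-1/3)" for k :: nat
  define \<epsilon> where "\<epsilon> k = \<delta> k + ln (4 * real k) / (real k * \<delta> k) + 1 / (2 * real k)" for k
  have "\<epsilon> \<longlonglongrightarrow> 0" unfolding \<epsilon>_def \<delta>_def by real_asymp
  moreover have "(1 - \<epsilon> k) * (2 * real k) \<le> real (coind_Z2 (VR_cube n k) bit_complement)"
    if k: "1 \<le> k" "real k < real n / 2" for k n
  proof -
    have \<delta>: "0 < \<delta> k" "\<delta> k \<le> 1" using k powr_mono[of "-1/3" 0 "real k"] by (auto simp: \<delta>_def)
    define r where "r = 2 * real k * (1 - \<delta> k) - 2 * ln (4 * real k) / \<delta> k"
    have r: "r - 1 = (1 - \<epsilon> k) * (2 * real k)"
      using k \<delta> by (simp add: r_def \<epsilon>_def field_simps)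
    have r_le: "r \<le> 2 * real k"
      using k \<delta> by (simp add: r_def algebra_simps)
    define D where "D = nat \<lfloor>r\<rfloor>"
    show ?thesis
    proof (cases "D = 0")
      case True
      then have "r < 1" unfolding D_def by linarith
      then show ?thesis using r by (smt (verit) of_nat_0_le_iff)
    next
      case False
      then have D: "real D \<le> r" "r - 1 < real D" unfolding D_def by linarith+
      have "D \<le> coind_Z2 (VR_cube n k) bit_complement"
      proof (rule coind_VR_cube_ge[where x = "1 + \<delta> k"])
        show "D < n" "k < n" using D r_le k by linarith+
        show "1 + \<delta> k \<ge> 1" using \<delta> by simp
        have "ln (2 * real D * ((1 + (1 + \<delta> k)) / 2) ^ D) = ln (2 * real D) + real D * ln (1 + \<delta> k / 2)"
          using False \<delta> by (simp add: ln_mult ln_realpow add_divide_distrib)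
        also have "\<dots> \<le> ln (4 * real k) + real D * (\<delta> k / 2)"
          using False \<delta> D r_le k by (intro add_mono mult_left_mono ln_add_one_self_le_self) auto
        also have "\<dots> \<le> ln (4 * real k) + r * (\<delta> k / 2)"
          using D \<delta> by (intro add_left_mono mult_right_mono) auto
        also have "\<dots> = real k * (\<delta> k - (\<delta> k)\<^sup>2)"
          using \<delta> by (simp add: r_def field_simps power2_eq_square)
        also have "\<dots> \<le> real k * ln (1 + \<delta> k)"
          using \<delta> by (intro mult_left_mono ln_one_plus_pos_lower_bound) auto
        also have "\<dots> < real (k + 1) * ln (1 + \<delta> k)"
          using \<delta> by (intro mult_strict_right_mono ln_gt_zero) auto
        also have "\<dots> = ln ((1 + \<delta> k) ^ (k + 1))" using \<delta> by (subst ln_realpow) auto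
        finally show "2 * real D * ((1 + (1 + \<delta> k)) / 2) ^ D < (1 + \<delta> k) ^ (k + 1)"
          using False \<delta> by (subst (asm) ln_less_cancel_iff) auto
      qed
      then show ?thesis using D r by linarith
    qed
  qed
  ultimately show ?thesis by blast
qed

end
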